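(* Let $N\ge 3$, let $\mathcal{L}=\sum_{j=1}^m X_j^2$ be a homogeneous Hörmander operator on $\mathbb{R}^N$ (as defined in the context), with associated dilations $\{\delta_\lambda\}_{\lambda>0}$, and let $\Omega\subseteq\mathbb{R}^N$ be an open set satisfying one of the following conditions: (i) $\mathbb{R}^N\setminus\Omega$ contains a non-degenerate $\delta_\lambda$-cone; (ii) $\Omega$ is contained in a half-space of $\mathbb{R}^N$. Then $\Omega$ is a maximum principle set for $\mathcal{L}$.
   Context: Homogeneous Hörmander operator: $X_1,\dots,X_m$ are smooth vector fields on $\mathbb{R}^N$, $N\ge3$, linearly independent (in the real vector space of smooth vector fields on $\mathbb{R}^N$), such that: (I) each $X_j$ is $\delta_\lambda$-homogeneous of degree $1$, i.e. $X_j(\varphi\circ\delta_\lambda)=\lambda\,(X_j\varphi)\circ\delta_\lambda$ for all $\varphi\in C^\infty(\mathbb{R}^N)$ and $\lambda>0$, where $\delta_\lambda(x)=(\lambda^{\sigma_1}x_1,\dots,\lambda^{\sigma_N}x_N)$ and $1=\sigma_1\le\dots\le\sigma_N$ are positive integers; (II) (Hörmander rank condition) $\dim\{X(x):X\in\mathrm{Lie}\{X_1,\dots,X_m\}\}=N$ for every $x\in\mathbb{R}^N$. Then $\mathcal{L}:=\sum_{j=1}^mX_j^2$. Potential theory: a function is $\mathcal{L}$-harmonic in an open set if it is a smooth solution of $\mathcal{L}u=0$ there. For $\Omega\subseteq\mathbb{R}^N$ open, an upper semicontinuous function $u:\Omega\to[-\infty,\infty)$ is $\mathcal{L}$-subharmonic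 in $\Omega$ if (i) $\{x\in\Omega:u(x)>-\infty\}$ is dense in $\Omega$; (ii) for every bounded open set $W$ with $\overline W\subseteq\Omega$ and every $h$ that is $\mathcal{L}$-harmonic in $W$, continuous up to $\partial W$ and satisfies $u\le h$ on $\partial W$, one has $u\le h$ in $W$. $\underline{\mathcal{L}}_b(\Omega)$ denotes the set of $\mathcal{L}$-subharmonic functions in $\Omega$ that are bounded above. Maximum principle set: an open set $\Omega\subseteq\mathbb{R}^N$ is a maximum principle set for $\mathcal{L}$ if every $u\in\underline{\mathcal{L}}_b(\Omega)$ such that $\limsup_{x\to\xi}u(x)\le 0$ for every $\xi\in\partial\Omega$ satisfies $u\le 0$ in $\Omega$. Non-degenerate $\delta_\lambda$-cone: a set $C\subseteq\mathbb{R}^N$ with $\mathrm{int}(C)\ne\varnothing$ for which there is $\lambda_0>0$ such that $\delta_\lambda(C)\subseteq C$ for every $\lambda\ge\lambda_0$. *)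

theory Defs
  imports "HOL-Analysis.Analysis"
begin

section \<open>Smooth functions and vector fields\<close>

(* For open S this is the usual class of k times continuously differentiable functions on S;
   smooth_on is only meaningful, and only used, for open S. *)
primrec Ck_on :: "nat \<Rightarrow> (real^'n) set \<Rightarrow> (real^'n \<Rightarrow> real) \<Rightarrow> bool" where
  "Ck_on 0 S f \<longleftrightarrow> continuous_on S f"
| "Ck_on (Suc k) S f \<longleftrightarrow> (\<forall>x\<in>S. f differentiable at x) \<and>
     (\<forall>i. Ck_on k S (\<lambda>x. frechet_derivative f (at x) (axis i 1)))"

definition smooth_on :: "(real^'n) set \<Rightarrow> (real^'n \<Rightarrow> real) \<Rightarrow> bool" where
  "smooth_on S f \<longleftrightarrow> (\<forall>k. Ck_on k S f)"

(* A vector field is identified with its vector of coefficient functions. *)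
definition smooth_vector_field :: "(real^'n \<Rightarrow> real^'n) \<Rightarrow> bool" where
  "smooth_vector_field X \<longleftrightarrow> (\<forall>i. smooth_on UNIV (\<lambda>x. X x $ i))"

definition vf_apply :: "(real^'n \<Rightarrow> real^'n) \<Rightarrow> (real^'n \<Rightarrow> real) \<Rightarrow> real^'n \<Rightarrow> real" where
  "vf_apply X f x = frechet_derivative f (at x) (X x)"

(* The coefficients of the commutator X o Y - Y o X of first-order operators. *)
definition lie_bracket ::
    "(real^'n \<Rightarrow> real^'n) \<Rightarrow> (real^'n \<Rightarrow> real^'n) \<Rightarrow> real^'n \<Rightarrow> real^'n" where
  "lie_bracket X Y x = frechet_derivative Y (at x) (X x) - frechet_derivative X (at x) (Y x)"

inductive_set lie_algebra :: "(real^'n \<Rightarrow> real^'n) set \<Rightarrow> (real^'n \<Rightarrow> real^'n) set"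
  for G :: "(real^'n \<Rightarrow> real^'n) set" where
  generator: "X \<in> G \<Longrightarrow> X \<in> lie_algebra G"
| zero: "(\<lambda>x. 0) \<in> lie_algebra G"
| add: "X \<in> lie_algebra G \<Longrightarrow> Y \<in> lie_algebra G \<Longrightarrow> (\<lambda>x. X x + Y x) \<in> lie_algebra G"
| scale: "X \<in> lie_algebra G \<Longrightarrow> (\<lambda>x. c *\<^sub>R X x) \<in> lie_algebra G"
| bracket: "X \<in> lie_algebra G \<Longrightarrow> Y \<in> lie_algebra G \<Longrightarrow> lie_bracket X Y \<in> lie_algebra G"

section \<open>Homogeneous Hoermander operators\<close>

definition dilation :: "('n \<Rightarrow> nat) \<Rightarrow> real \<Rightarrow> real^'n \<Rightarrow> real^'n" where
  "dilation \<sigma> r x = (\<chi> i. r ^ \<sigma> i * x $ i)"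

(* The coordinates are indexed by a finite linear order, so that the exponents can be
   required to be nondecreasing with least value 1 at the first coordinate.
   Linear independence refers to constant coefficients, i.e. to the real vector space of
   vector fields, and not to linear independence at each point. *)
definition homogeneous_hoermander ::
    "('n::{finite,linorder} \<Rightarrow> nat) \<Rightarrow> nat \<Rightarrow>
      (nat \<Rightarrow> (real, 'n) vec \<Rightarrow> (real, 'n) vec) \<Rightarrow> bool" where
  "homogeneous_hoermander \<sigma> m X \<longleftrightarrow>
     \<sigma> (Min UNIV) = 1 \<and> mono \<sigma> \<and>
     (\<forall>j\<in>{1..m}. smooth_vector_field (X j)) \<and>
     (\<forall>c::nat \<Rightarrow> real. (\<forall>x. (\<Sum>j=1..m. c j *\<^sub>R X j x) = 0) \<longrightarrow> (\<forall>j\<in>{1..m}. c j = 0)) \<and>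
     (\<forall>j\<in>{1..m}. \<forall>\<phi>. smooth_on UNIV \<phi> \<longrightarrow>
        (\<forall>r>0. \<forall>x. vf_apply (X j) (\<phi> \<circ> dilation \<sigma> r) x =
                     r * vf_apply (X j) \<phi> (dilation \<sigma> r x))) \<and>
     (\<forall>x. dim ((\<lambda>Y. Y x) ` lie_algebra (X ` {1..m})) = CARD('n))"

definition sum_of_squares ::
    "nat \<Rightarrow> (nat \<Rightarrow> real^'n \<Rightarrow> real^'n) \<Rightarrow> (real^'n \<Rightarrow> real) \<Rightarrow> real^'n \<Rightarrow> real" where
  "sum_of_squares m X u x = (\<Sum>j=1..m. vf_apply (X j) (vf_apply (X j) u) x)"

section \<open>Potential theory\<close>

definition harmonic_on ::
    "((real^'n \<Rightarrow> real) \<Rightarrow> real^'n \<Rightarrow> real) \<Rightarrow> (real^'n) set \<Rightarrow> (real^'n \<Rightarrow> real) \<Rightarrow> bool" where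
  "harmonic_on L W u \<longleftrightarrow> smooth_on W u \<and> (\<forall>x\<in>W. L u x = 0)"

definition usc_on :: "'a::topological_space set \<Rightarrow> ('a \<Rightarrow> ereal) \<Rightarrow> bool" where
  "usc_on S u \<longleftrightarrow> (\<forall>a. openin (top_of_set S) {x\<in>S. u x < a})"

definition subharmonic_on ::
    "((real^'n \<Rightarrow> real) \<Rightarrow> real^'n \<Rightarrow> real) \<Rightarrow> (real^'n) set \<Rightarrow> (real^'n \<Rightarrow> ereal) \<Rightarrow> bool" where
  "subharmonic_on L \<Omega> u \<longleftrightarrow>
     (\<forall>x\<in>\<Omega>. u x < \<infinity>) \<and> usc_on \<Omega> u \<and>
     \<Omega> \<subseteq> closure {x\<in>\<Omega>. u x > -\<infinity>} \<and>
     (\<forall>W h. open W \<and> bounded W \<and> closure W \<subseteq> \<Omega> \<and>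
        harmonic_on L W h \<and> continuous_on (closure W) h \<and>
        (\<forall>x\<in>frontier W. u x \<le> ereal (h x))
        \<longrightarrow> (\<forall>x\<in>W. u x \<le> ereal (h x)))"

definition subharmonic_bdd_above ::
    "((real^'n \<Rightarrow> real) \<Rightarrow> real^'n \<Rightarrow> real) \<Rightarrow> (real^'n) set \<Rightarrow> (real^'n \<Rightarrow> ereal) set" where
  "subharmonic_bdd_above L \<Omega> =
     {u. subharmonic_on L \<Omega> u \<and> (\<exists>M::real. \<forall>x\<in>\<Omega>. u x \<le> ereal M)}"

(* Only finite boundary points are tested: for unbounded \<Omega> there is no condition at infinity. *)
definition maximum_principle_set ::
    "((real^'n \<Rightarrow> real) \<Rightarrow> real^'n \<Rightarrow> real) \<Rightarrow> (real^'n) set \<Rightarrow> bool" where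
  "maximum_principle_set L \<Omega> \<longleftrightarrow> open \<Omega> \<and>
     (\<forall>u\<in>subharmonic_bdd_above L \<Omega>.
        (\<forall>\<xi>\<in>frontier \<Omega>. Limsup (at \<xi> within \<Omega>) u \<le> 0) \<longrightarrow> (\<forall>x\<in>\<Omega>. u x \<le> 0))"

section \<open>Cones and half-spaces\<close>

definition nondegenerate_cone :: "('n \<Rightarrow> nat) \<Rightarrow> (real^'n) set \<Rightarrow> bool" where
  "nondegenerate_cone \<sigma> C \<longleftrightarrow> interior C \<noteq> {} \<and>
     (\<exists>r0>0. \<forall>r\<ge>r0. dilation \<sigma> r ` C \<subseteq> C)"

(* Closed half-spaces with arbitrary normal direction and offset; being contained in an open
   half-space is a special case. *)
definition halfspace :: "'a::euclidean_space set \<Rightarrow> bool" where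
  "halfspace H \<longleftrightarrow> (\<exists>a b. a \<noteq> 0 \<and> H = {x. inner a x \<le> b})"

end

(* The class of test functions is that of polynomials. Smoothness at the origin makes the
   coefficients of the fields polynomial, and L is noncharacteristic in the first coordinate, whose
   derivative along each field is constant; so L w = p has polynomial solutions w vanishing to second
   order on a hyperplane x_1 = t. Adding such a w to a polynomial phi with L phi(z) < 0 gives a
   harmonic function above phi near z, so a subharmonic function is a viscosity subsolution. No
   hypoellipticity and no solution of a Dirichlet problem is needed.

   Let v = max(u, 0), extended by 0, have supremum M > 0. Let F be the set of points at which the
   rescalings of v by large dilations approach M. Then F contains 0, because every value of v is
   moved towards 0 by the rescaling, and F misses the interior points of the cone. A Hopf barrier
   shows that the fields X_j are tangent to F, hence so is their Lie algebra (Bony), and the rank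
   condition forces F to be empty or everything, a contradiction. A half-space is reduced to the cone
   case, since its complement contains a nondegenerate cone. *)

theory Submission
  imports Defs
begin


section \<open>Polynomial functions and vector fields\<close>

text \<open>The supremum of \<open>v\<close> may be approached only at infinity, where nothing is
  assumed, so \<open>v\<close> need not attain it anywhere; this forces the passage to large scales.
  The passage respects the operator because composition with a dilation gives \<open>L\<close> only
  a factor \<open>r^2\<close>: a polynomial touching a rescaling of \<open>v\<close> from above can
  be moved back to touch \<open>v\<close>. Noncharacteristic hyperplanes control the sign of a
  polynomial solution: on \<open>x $ i0 = t\<close>, applying \<open>L\<close> to
  \<open>(x $ i0 - t)^2 * W x\<close> leaves \<open>2 * a0 * W x\<close>, so a positive right-hand
  side makes the solution nonnegative nearby. The recursion for \<open>W\<close> stops because every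
  field lowers the weighted degree by one. Tangency to F is expressed by test functions instead of
  integral curves. Sums and multiples of fields are then immediate, and brackets are the obstacle:
  four flows have to be composed with an error smaller than the second order commutator term. Each
  flow is therefore cut into many short steps, and each step is compared at a maximum point over
  F.\<close>

lemmas real_polynomial_function_linear = real_polynomial_function.intros(1)
lemmas real_polynomial_function_const = real_polynomial_function.intros(2)
lemmas real_polynomial_function_add = real_polynomial_function.intros(3)
lemmas real_polynomial_function_mult = real_polynomial_function.intros(4)

lemma has_derivative_real_polynomial_function:
  "real_polynomial_function f \<Longrightarrow> (f has_derivative frechet_derivative f (at x)) (at x)"
  using differentiable_at_real_polynomial_function frechet_derivative_works by blast

lemma frechet_derivative_bounded_linear:
  "bounded_linear f \<Longrightarrow> frechet_derivative f (at x) = f"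
  by (metis bounded_linear_imp_has_derivative frechet_derivative_at)

lemma frechet_derivative_poly_add:
  assumes "real_polynomial_function f" "real_polynomial_function g"
  shows "frechet_derivative (\<lambda>x. f x + g x) (at x) =
           (\<lambda>h. frechet_derivative f (at x) h + frechet_derivative g (at x) h)"
  using assms
  by (intro frechet_derivative_at [symmetric] has_derivative_add
      has_derivative_real_polynomial_function)

lemma frechet_derivative_poly_mult:
  assumes "real_polynomial_function f" "real_polynomial_function g"
  shows "frechet_derivative (\<lambda>x. f x * g x) (at x) =
           (\<lambda>h. f x * frechet_derivative g (at x) h + frechet_derivative f (at x) h * g x)"
  using assms
  by (intro frechet_derivative_at [symmetric] has_derivative_mult
      has_derivative_real_polynomial_function)

lemma real_polynomial_function_frechet_derivative:
  assumes "real_polynomial_function f"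
  shows "real_polynomial_function (\<lambda>x. frechet_derivative f (at x) e)"
  using assms
proof (induction f rule: real_polynomial_function.induct)
  case (linear f)
  then show ?case by (simp add: frechet_derivative_bounded_linear real_polynomial_function_const)
next
  case (const c)
  then show ?case by (simp add: real_polynomial_function_const)
next
  case (add f g)
  then show ?case
    by (simp add: frechet_derivative_poly_add real_polynomial_function_add)
next
  case (mult f g)
  then show ?case
    by (simp add: frechet_derivative_poly_mult real_polynomial_function_add
        real_polynomial_function_mult)
qed

lemma real_polynomial_function_nth: "real_polynomial_function (\<lambda>x::real^'n. x $ i)"
  by (simp add: bounded_linear_vec_nth real_polynomial_function_linear)

lemma polynomial_function_iff_nth:
  "polynomial_function (Z :: real^'n \<Rightarrow> real^'n) \<longleftrightarrow> (\<forall>i. real_polynomial_function (\<lambda>x. Z x $ i))"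
  by (auto simp: polynomial_function_iff_Basis_inner Basis_vec_def inner_axis)

lemma frechet_derivative_expand:
  fixes f :: "real^'n \<Rightarrow> real"
  assumes "f differentiable at x"
  shows "frechet_derivative f (at x) h = (\<Sum>i\<in>UNIV. h $ i * frechet_derivative f (at x) (axis i 1))"
proof -
  have l: "linear (frechet_derivative f (at x))"
    using assms by (rule linear_frechet_derivative)
  have "frechet_derivative f (at x) (\<Sum>i\<in>UNIV. h $ i *\<^sub>R axis i 1) =
          (\<Sum>i\<in>UNIV. h $ i * frechet_derivative f (at x) (axis i 1))"
    by (simp add: linear_sum [OF l] linear_cmul [OF l])
  moreover have "(\<Sum>i\<in>UNIV. h $ i *\<^sub>R axis i 1) = h"
    using basis_expansion [of h] by (simp add: scalar_mult_eq_scaleR)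
  ultimately show ?thesis by simp
qed

lemma real_polynomial_function_vf_apply:
  fixes Z :: "real^'n \<Rightarrow> real^'n"
  assumes "polynomial_function Z" "real_polynomial_function f"
  shows "real_polynomial_function (vf_apply Z f)"
proof -
  have "vf_apply Z f = (\<lambda>x. \<Sum>i\<in>UNIV. Z x $ i * frechet_derivative f (at x) (axis i 1))"
    using assms by (auto simp: vf_apply_def frechet_derivative_expand differentiable_at_real_polynomial_function)
  moreover have "real_polynomial_function
      (\<lambda>x. \<Sum>i\<in>UNIV. Z x $ i * frechet_derivative f (at x) (axis i 1))"
    using assms by (intro real_polynomial_function_sum real_polynomial_function_mult
        real_polynomial_function_frechet_derivative)
      (auto simp: polynomial_function_iff_nth)
  ultimately show ?thesis by simp
qed

lemma vf_apply_const: "vf_apply Z (\<lambda>x. c) = (\<lambda>x. 0)"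
  by (auto simp: vf_apply_def)

lemma vf_apply_bounded_linear: "bounded_linear f \<Longrightarrow> vf_apply Z f = (\<lambda>x. f (Z x))"
  by (auto simp: vf_apply_def frechet_derivative_bounded_linear)

lemma vf_apply_nth: "vf_apply Z (\<lambda>x. x $ i) = (\<lambda>x. Z x $ i)"
  by (simp add: vf_apply_bounded_linear bounded_linear_vec_nth)

lemma vf_apply_add:
  assumes "real_polynomial_function f" "real_polynomial_function g"
  shows "vf_apply Z (\<lambda>x. f x + g x) = (\<lambda>x. vf_apply Z f x + vf_apply Z g x)"
  using assms by (auto simp: vf_apply_def frechet_derivative_poly_add)

lemma vf_apply_mult:
  assumes "real_polynomial_function f" "real_polynomial_function g"
  shows "vf_apply Z (\<lambda>x. f x * g x) = (\<lambda>x. f x * vf_apply Z g x + vf_apply Z f x * g x)"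
  using assms by (auto simp: vf_apply_def frechet_derivative_poly_mult)

lemma vf_apply_cmult:
  assumes "real_polynomial_function f"
  shows "vf_apply Z (\<lambda>x. c * f x) = (\<lambda>x. c * vf_apply Z f x)"
  using vf_apply_mult [OF real_polynomial_function_const assms] by (simp add: vf_apply_const)

lemma vf_apply_diff:
  assumes "real_polynomial_function f" "real_polynomial_function g"
  shows "vf_apply Z (\<lambda>x. f x - g x) = (\<lambda>x. vf_apply Z f x - vf_apply Z g x)"
  using vf_apply_add [OF assms(1) real_polynomial_function_minus [OF assms(2)], of Z]
    vf_apply_cmult [OF assms(2), of Z "-1"] by simp

lemma vf_apply_power:
  assumes "real_polynomial_function f"
  shows "vf_apply Z (\<lambda>x. f x ^ Suc n) = (\<lambda>x. (n + 1) * f x ^ n * vf_apply Z f x)"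
proof (induction n)
  case 0
  then show ?case by simp
next
  case (Suc n)
  have "vf_apply Z (\<lambda>x. f x * f x ^ Suc n) =
          (\<lambda>x. f x * ((n + 1) * f x ^ n * vf_apply Z f x) + vf_apply Z f x * f x ^ Suc n)"
    using vf_apply_mult [OF assms real_polynomial_function_power [OF assms], of Z "Suc n"] Suc
    by (simp add: add.commute)
  then show ?case by (simp add: algebra_simps fun_eq_iff)
qed

lemma vf_apply_field_add:
  assumes "real_polynomial_function f"
  shows "vf_apply (\<lambda>x. Y x + Z x) f x = vf_apply Y f x + vf_apply Z f x"
  using linear_frechet_derivative [OF differentiable_at_real_polynomial_function [OF assms]]
  by (simp add: vf_apply_def linear_add)

lemma vf_apply_field_scale:
  assumes "real_polynomial_function f"
  shows "vf_apply (\<lambda>x. c *\<^sub>R Z x) f x = c * vf_apply Z f x"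
  using linear_frechet_derivative [OF differentiable_at_real_polynomial_function [OF assms]]
  by (simp add: vf_apply_def linear_cmul)

lemma vf_apply_field_zero:
  assumes "real_polynomial_function f"
  shows "vf_apply (\<lambda>x. 0) f x = 0"
  using linear_frechet_derivative [OF differentiable_at_real_polynomial_function [OF assms]]
  by (simp add: vf_apply_def linear_0)

lemma bounded_linear_vf_apply:
  assumes "bounded_linear f" "polynomial_function (Y :: real^'n \<Rightarrow> real^'n)"
  shows "vf_apply X (\<lambda>x. f (Y x)) x = f (frechet_derivative Y (at x) (X x))"
proof -
  have "(Y has_derivative frechet_derivative Y (at x)) (at x)"
    using differentiable_at_polynomial_function [OF assms(2)] by (simp flip: frechet_derivative_works)
  then have "((\<lambda>x. f (Y x)) has_derivative (\<lambda>h. f (frechet_derivative Y (at x) h))) (at x)"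
    by (rule bounded_linear.has_derivative [OF assms(1)])
  from frechet_derivative_at [OF this, symmetric] show ?thesis by (simp add: vf_apply_def)
qed

text \<open>For linear \<open>f\<close> this unfolds to the definition of
  \<open>lie_bracket\<close>. For a product, the mixed terms of the second order Leibniz rule are
  symmetric in the two fields and cancel in the commutator.\<close>

lemma vf_apply_lie_bracket:
  fixes X Y :: "real^'n \<Rightarrow> real^'n"
  assumes X: "polynomial_function X" and Y: "polynomial_function Y"
    and f: "real_polynomial_function f"
  shows "vf_apply (lie_bracket X Y) f x = vf_apply X (vf_apply Y f) x - vf_apply Y (vf_apply X f) x"
  using f
proof (induction f arbitrary: x rule: real_polynomial_function.induct)
  case (linear f)
  then show ?case
    by (simp add: vf_apply_bounded_linear bounded_linear_vf_apply X Y lie_bracket_def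
        linear_diff bounded_linear.linear)
next
  case (const c)
  then show ?case by (simp add: vf_apply_const)
next
  case (add f g)
  then show ?case
    by (simp add: vf_apply_add real_polynomial_function_vf_apply X Y)
next
  case (mult f g)
  have 1: "vf_apply P (vf_apply Q (\<lambda>x. f x * g x)) x =
      f x * vf_apply P (vf_apply Q g) x + vf_apply P f x * vf_apply Q g x
      + (vf_apply Q f x * vf_apply P g x + vf_apply P (vf_apply Q f) x * g x)"
    if "polynomial_function P" "polynomial_function Q" for P Q
    using mult that by (simp add: vf_apply_add vf_apply_mult real_polynomial_function_vf_apply
        real_polynomial_function_mult)
  show ?case
    unfolding 1 [OF X Y] 1 [OF Y X] unfolding vf_apply_mult [OF mult.hyps] mult.IH
    by (simp add: algebra_simps)
qed

lemma polynomial_function_lie_bracket: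
  fixes X Y :: "real^'n \<Rightarrow> real^'n"
  assumes X: "polynomial_function X" and Y: "polynomial_function Y"
  shows "polynomial_function (lie_bracket X Y)"
  unfolding polynomial_function_iff_nth
proof
  fix i
  have "(\<lambda>x. lie_bracket X Y x $ i) = vf_apply (lie_bracket X Y) (\<lambda>x. x $ i)"
    by (simp add: vf_apply_nth)
  also have "\<dots> = (\<lambda>x. vf_apply X (vf_apply Y (\<lambda>x. x $ i)) x - vf_apply Y (vf_apply X (\<lambda>x. x $ i)) x)"
    using vf_apply_lie_bracket [OF X Y real_polynomial_function_nth] by blast
  finally show "real_polynomial_function (\<lambda>x. lie_bracket X Y x $ i)"
    by (simp add: real_polynomial_function_diff real_polynomial_function_vf_apply X Y
        real_polynomial_function_nth)
qed

lemma polynomial_function_lie_algebra: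
  assumes "Y \<in> lie_algebra G" "\<And>X. X \<in> G \<Longrightarrow> polynomial_function X"
  shows "polynomial_function Y"
  using assms(1)
  by (induction rule: lie_algebra.induct)
    (auto intro: assms(2) polynomial_function_lie_bracket)

lemma smooth_on_real_polynomial_function:
  assumes "real_polynomial_function f"
  shows "smooth_on S f"
proof -
  have "Ck_on k S f" for k
    using assms
  proof (induction k arbitrary: f)
    case 0
    then show ?case
      by (auto simp: continuous_real_polymonial_function continuous_at_imp_continuous_on)
  next
    case (Suc k)
    then show ?case
      by (simp add: differentiable_at_real_polynomial_function real_polynomial_function_frechet_derivative)
  qed
  then show ?thesis by (simp add: smooth_on_def)
qed

lemma continuous_on_real_polynomial_function:
  "real_polynomial_function f \<Longrightarrow> continuous_on S f"
  by (simp add: continuous_real_polymonial_function continuous_at_imp_continuous_on)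

section \<open>Dilations\<close>

lemma dilation_nth [simp]: "dilation \<sigma> r x $ i = r ^ \<sigma> i * x $ i"
  by (simp add: dilation_def)

lemma bounded_linear_dilation: "bounded_linear (dilation \<sigma> r :: real^'n \<Rightarrow> real^'n)"
proof -
  have "linear (dilation \<sigma> r :: real^'n \<Rightarrow> real^'n)"
    by (rule linearI) (auto simp: vec_eq_iff algebra_simps)
  then show ?thesis by (simp add: linear_conv_bounded_linear)
qed

lemma dilation_dilation: "dilation \<sigma> r (dilation \<sigma> s x) = dilation \<sigma> (r * s) x"
  by (simp add: vec_eq_iff power_mult_distrib)

lemma dilation_one [simp]: "dilation \<sigma> 1 x = x"
  by (simp add: vec_eq_iff)

lemma tendsto_dilation_0:
  fixes x :: "real^'n"
  assumes "\<And>i. \<sigma> i \<ge> 1"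
  shows "((\<lambda>r. dilation \<sigma> r x) \<longlongrightarrow> 0) (at_right 0)"
proof (rule vec_tendstoI)
  fix i
  have "((\<lambda>r::real. r ^ \<sigma> i * x $ i) \<longlongrightarrow> 0 ^ \<sigma> i * x $ i) (at_right 0)"
    by (intro tendsto_intros)
  then show "((\<lambda>r. dilation \<sigma> r x $ i) \<longlongrightarrow> 0 $ i) (at_right 0)"
    using assms [of i] by (simp add: power_0_left)
qed

lemma tendsto_at_dilation_0:
  fixes f :: "real^'n \<Rightarrow> real"
  assumes "\<And>i. \<sigma> i \<ge> 1" "continuous_on UNIV f"
  shows "((\<lambda>r. f (dilation \<sigma> r x)) \<longlongrightarrow> f 0) (at_right 0)"
  using assms tendsto_dilation_0 [of \<sigma> x]
  by (metis UNIV_I continuous_on_eq_continuous_at isCont_tendsto_compose open_UNIV)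

text \<open>Differentiate the homogeneity relation along the orbit of \<open>x\<close> at
  \<open>r = 1\<close>.\<close>

lemma Euler_homogeneous:
  fixes f :: "real^'n \<Rightarrow> real"
  assumes d: "f differentiable at x" and h: "\<And>r. r > 0 \<Longrightarrow> f (dilation \<sigma> r x) = r ^ k * f x"
  shows "k * f x = (\<Sum>i\<in>UNIV. \<sigma> i * x $ i * frechet_derivative f (at x) (axis i 1))"
proof -
  define e :: "real^'n" where "e = (\<chi> i. \<sigma> i * x $ i)"
  have D: "(f has_derivative frechet_derivative f (at x)) (at (dilation \<sigma> 1 x))"
    using d by (simp flip: frechet_derivative_works)
  have "((\<lambda>r. dilation \<sigma> r x) has_derivative (\<lambda>t. t *\<^sub>R e)) (at 1)"
    by (subst has_derivative_componentwise_within)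
      (auto simp: Basis_vec_def inner_axis e_def intro!: derivative_eq_intros)
  then have "((\<lambda>r. f (dilation \<sigma> r x)) has_derivative (\<lambda>t. frechet_derivative f (at x) (t *\<^sub>R e))) (at 1)"
    by (rule has_derivative_compose [where g = f]) (rule D)
  then have 1: "((\<lambda>r. f (dilation \<sigma> r x)) has_derivative (\<lambda>t. t * frechet_derivative f (at x) e)) (at 1)"
    by (simp add: linear_cmul [OF linear_frechet_derivative [OF d]])
  have "((\<lambda>r::real. r ^ k * f x) has_derivative (\<lambda>t. t * (k * f x))) (at 1)"
    by (auto intro!: derivative_eq_intros)
  then have "((\<lambda>r. f (dilation \<sigma> r x)) has_derivative (\<lambda>t. t * (k * f x))) (at 1)"
    by (rule has_derivative_transform_within_open [where s="{0<..}"]) (auto simp: h)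
  with 1 have "(\<lambda>t. t * frechet_derivative f (at x) e) = (\<lambda>t. t * (k * f x))"
    by (rule has_derivative_unique)
  from fun_cong [OF this, of 1] have "k * f x = frechet_derivative f (at x) e" by simp
  then show ?thesis using frechet_derivative_expand [OF d, of e] by (simp add: e_def)
qed

text \<open>Smoothness at the origin forces a homogeneous function to be polynomial: partial derivatives
  of negative degree vanish, and Euler's identity recovers the function from the others.\<close>

lemma homogeneous_smooth_imp_polynomial:
  fixes f :: "real^'n \<Rightarrow> real"
  assumes \<sigma>: "\<And>i. \<sigma> i \<ge> 1" and "smooth_on UNIV f"
    and "\<And>r x. r > 0 \<Longrightarrow> f (dilation \<sigma> r x) = r ^ k * f x"
  shows "real_polynomial_function f"
  using assms(2,3)
proof (induction k arbitrary: f rule: less_induct)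
  case (less k)
  have diff: "f differentiable at x" for x
    using less.prems(1) unfolding smooth_on_def by (metis Ck_on.simps(2) UNIV_I)
  have cont: "continuous_on UNIV f"
    using diff differentiable_imp_continuous_within continuous_at_imp_continuous_on by blast
  define g where "g i x = frechet_derivative f (at x) (axis i 1)" for i x
  have sg: "smooth_on UNIV (g i)" for i
    using less.prems(1) unfolding smooth_on_def g_def by (metis Ck_on.simps(2))
  \<comment> \<open>The chain rule makes \<open>g i\<close> homogeneous of degree
    \<open>k - \<sigma> i\<close>. The power stays on the left because this degree may be
    negative.\<close>
  have hg: "r ^ \<sigma> i * g i (dilation \<sigma> r x) = r ^ k * g i x" if "r > 0" for r x i
  proof -
    have bl: "bounded_linear (dilation \<sigma> r :: real^'n \<Rightarrow> real^'n)" by (rule bounded_linear_dilation)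
    have "(f has_derivative frechet_derivative f (at (dilation \<sigma> r x))) (at (dilation \<sigma> r x))"
      using diff frechet_derivative_works by blast
    then have "((\<lambda>x. f (dilation \<sigma> r x)) has_derivative
        (\<lambda>h. frechet_derivative f (at (dilation \<sigma> r x)) (dilation \<sigma> r h))) (at x)"
      by (rule has_derivative_compose [where g = f, OF bounded_linear_imp_has_derivative [OF bl]])
    moreover have "((\<lambda>x. r ^ k * f x) has_derivative (\<lambda>h. r ^ k * frechet_derivative f (at x) h)) (at x)"
      using diff by (intro derivative_intros) (simp flip: frechet_derivative_works)
    moreover have "(\<lambda>x. f (dilation \<sigma> r x)) = (\<lambda>x. r ^ k * f x)"
      using less.prems(2) that by auto
    ultimately have "(\<lambda>h. frechet_derivative f (at (dilation \<sigma> r x)) (dilation \<sigma> r h)) =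
        (\<lambda>h. r ^ k * frechet_derivative f (at x) h)"
      using has_derivative_unique by metis
    then have "frechet_derivative f (at (dilation \<sigma> r x)) (dilation \<sigma> r (axis i 1)) = r ^ k * g i x"
      by (auto simp: g_def dest: fun_cong)
    moreover have "dilation \<sigma> r (axis i 1) = r ^ \<sigma> i *\<^sub>R axis i 1"
      by (simp add: vec_eq_iff axis_def)
    ultimately show ?thesis
      by (simp add: g_def linear_cmul [OF linear_frechet_derivative [OF diff]])
  qed
  have pg: "real_polynomial_function (g i)" for i
  proof (cases "\<sigma> i \<le> k")
    case True
    show ?thesis
    proof (rule less.IH [of "k - \<sigma> i"])
      show "k - \<sigma> i < k" using True \<sigma> [of i] by linarith
      show "g i (dilation \<sigma> r x) = r ^ (k - \<sigma> i) * g i x" if "r > 0" for r x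
        using hg [OF that, of i x] that True by (simp add: power_diff field_simps)
    qed (rule sg)
  next
    case False
    have "g i x = 0" for x
    proof -
      \<comment> \<open>By continuity at the origin \<open>g i\<close> converges along the orbit,
        and the positive power of \<open>r\<close> in front forces the constant value
        \<open>g i x\<close> to be 0.\<close>
      have "continuous_on UNIV (g i)" using sg [of i] by (metis Ck_on.simps(1) smooth_on_def)
      then have "((\<lambda>r. r ^ (\<sigma> i - k) * g i (dilation \<sigma> r x)) \<longlongrightarrow> 0 ^ (\<sigma> i - k) * g i 0) (at_right 0)"
        using \<sigma> by (intro tendsto_intros tendsto_at_dilation_0)
      moreover have "\<forall>\<^sub>F r in at_right 0. r ^ (\<sigma> i - k) * g i (dilation \<sigma> r x) = g i x"
        using eventually_at_right_less [of 0]
      proof eventually_elim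
        case (elim r)
        then show ?case using hg [OF elim, of i x] False by (simp add: power_diff field_simps)
      qed
      ultimately have "((\<lambda>r::real. g i x) \<longlongrightarrow> 0 ^ (\<sigma> i - k) * g i 0) (at_right 0)"
        by (rule Lim_transform_eventually)
      then show ?thesis using False by (simp add: tendsto_const_iff power_0_left)
    qed
    then have "g i = (\<lambda>x. 0)" by blast
    then show ?thesis by (simp add: real_polynomial_function_const)
  qed
  show ?case
  proof (cases "k = 0")
    case True
    \<comment> \<open>Euler's identity would divide by \<open>k\<close>. In degree 0 the function is
      constant along orbits, all of which tend to the origin.\<close>
    have "f x = f 0" for x
    proof -
      have "((\<lambda>r. f (dilation \<sigma> r x)) \<longlongrightarrow> f 0) (at_right 0)"
        using \<sigma> cont by (rule tendsto_at_dilation_0)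
      moreover have "\<forall>\<^sub>F r in at_right 0. f (dilation \<sigma> r x) = f x"
        using eventually_at_right_less [of 0] by eventually_elim (simp add: less.prems(2) True)
      ultimately have "((\<lambda>r::real. f x) \<longlongrightarrow> f 0) (at_right 0)"
        by (rule Lim_transform_eventually)
      then show ?thesis by (simp add: tendsto_const_iff)
    qed
    then have "f = (\<lambda>x. f 0)" by blast
    then show ?thesis by (metis real_polynomial_function_const)
  next
    case False
    have "f = (\<lambda>x. (\<Sum>i\<in>UNIV. \<sigma> i * x $ i * g i x) / k)"
      using Euler_homogeneous [OF diff less.prems(2)] False by (auto simp: g_def field_simps)
    moreover have "real_polynomial_function (\<lambda>x. (\<Sum>i\<in>UNIV. \<sigma> i * x $ i * g i x) / k)"
      using pg by (intro real_polynomial_function_divide real_polynomial_function_sum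
          real_polynomial_function_mult real_polynomial_function_const real_polynomial_function_nth) auto
    ultimately show ?thesis by simp
  qed
qed


section \<open>The squared distance as a polynomial penalty\<close>

lemma norm_diff_power2_eq_sum:
  fixes z :: "real^'n"
  shows "(norm (x - z))\<^sup>2 = (\<Sum>i\<in>UNIV. (x $ i - z $ i)\<^sup>2)"
  unfolding power2_norm_eq_inner by (simp add: inner_vec_def power2_eq_square)

lemma real_polynomial_function_norm_diff_power2:
  fixes z :: "real^'n"
  shows "real_polynomial_function (\<lambda>x. (norm (x - z))\<^sup>2)"
  unfolding norm_diff_power2_eq_sum
  by (intro real_polynomial_function_sum real_polynomial_function_power
      real_polynomial_function_diff real_polynomial_function_const real_polynomial_function_nth) auto

lemma vf_apply_norm_diff_power2:
  fixes z :: "real^'n"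
  shows "vf_apply Z (\<lambda>x. (norm (x - z))\<^sup>2) x = 2 * (Z x \<bullet> (x - z))"
proof -
  have "((\<lambda>x. (x - z) \<bullet> (x - z)) has_derivative (\<lambda>h. (x - z) \<bullet> h + h \<bullet> (x - z))) (at x)"
    by (auto intro!: derivative_eq_intros)
  from frechet_derivative_at [OF this, symmetric] show ?thesis
    by (simp add: vf_apply_def power2_norm_eq_inner inner_commute)
qed

section \<open>Homogeneity of the fields and calculus of \<open>L\<close> on polynomials\<close>

locale hoermander =
  fixes \<sigma> :: "'n::{finite,linorder} \<Rightarrow> nat" and m :: nat and X :: "nat \<Rightarrow> (real, 'n) vec \<Rightarrow> (real, 'n) vec"
  assumes homogeneous_hoermander: "homogeneous_hoermander \<sigma> m X"
begin

abbreviation D :: "nat \<Rightarrow> ((real, 'n) vec \<Rightarrow> real) \<Rightarrow> (real, 'n) vec \<Rightarrow> real" where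
  "D j \<equiv> vf_apply (X j)"

abbreviation L :: "((real, 'n) vec \<Rightarrow> real) \<Rightarrow> (real, 'n) vec \<Rightarrow> real" where
  "L \<equiv> sum_of_squares m X"

definition i0 :: 'n where "i0 = Min UNIV"

lemma sigma_i0: "\<sigma> i0 = 1"
  using homogeneous_hoermander by (simp add: homogeneous_hoermander_def i0_def)

lemma sigma_ge_1: "\<sigma> i \<ge> 1"
proof -
  have "\<sigma> i0 \<le> \<sigma> i"
    using homogeneous_hoermander Min_le [OF finite UNIV_I]
    unfolding homogeneous_hoermander_def i0_def mono_def by blast
  then show ?thesis by (simp add: sigma_i0)
qed

lemma D_dilation:
  assumes "j \<in> {1..m}" "real_polynomial_function \<phi>" "r > 0"
  shows "D j (\<lambda>x. \<phi> (dilation \<sigma> r x)) x = r * D j \<phi> (dilation \<sigma> r x)"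
  using homogeneous_hoermander assms smooth_on_real_polynomial_function [OF assms(2)]
  unfolding homogeneous_hoermander_def o_def by blast

text \<open>Homogeneity of the field tested on the coordinate function \<open>x $ i\<close>. The
  truncated subtraction is harmless by \<open>sigma_ge_1\<close>.\<close>

lemma X_dilation:
  assumes j: "j \<in> {1..m}" and r: "r > 0"
  shows "X j (dilation \<sigma> r x) $ i = r ^ (\<sigma> i - 1) * X j x $ i"
proof -
  have "D j (\<lambda>x. dilation \<sigma> r x $ i) x = r * X j (dilation \<sigma> r x) $ i"
    using D_dilation [OF j real_polynomial_function_nth r, of i x] by (simp add: vf_apply_nth)
  moreover have "D j (\<lambda>x. dilation \<sigma> r x $ i) x = r ^ \<sigma> i * X j x $ i"
    by (simp add: vf_apply_cmult real_polynomial_function_nth vf_apply_nth)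
  moreover have "r ^ \<sigma> i = r * r ^ (\<sigma> i - 1)"
    using sigma_ge_1 [of i] by (metis power_eq_if not_one_le_zero)
  ultimately show ?thesis using r by simp
qed

lemma X_polynomial: "j \<in> {1..m} \<Longrightarrow> polynomial_function (X j)"
  unfolding polynomial_function_iff_nth
proof
  fix i
  assume j: "j \<in> {1..m}"
  have "smooth_on UNIV (\<lambda>x. X j x $ i)"
    using homogeneous_hoermander j
    unfolding homogeneous_hoermander_def smooth_vector_field_def by blast
  then show "real_polynomial_function (\<lambda>x. X j x $ i)"
    by (rule homogeneous_smooth_imp_polynomial [OF sigma_ge_1]) (rule X_dilation [OF j])
qed

lemma lie_algebra_polynomial:
  assumes "Y \<in> lie_algebra (X ` {1..m})"
  shows "polynomial_function Y"
  using assms by (rule polynomial_function_lie_algebra) (auto intro: X_polynomial)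

lemma span_lie_algebra: "span ((\<lambda>Y. Y x) ` lie_algebra (X ` {1..m})) = UNIV"
proof -
  have "dim ((\<lambda>Y. Y x) ` lie_algebra (X ` {1..m})) = CARD('n)"
    using homogeneous_hoermander unfolding homogeneous_hoermander_def by blast
  then show ?thesis by (simp flip: dim_eq_full)
qed

lemma D_polynomial:
  "j \<in> {1..m} \<Longrightarrow> real_polynomial_function f \<Longrightarrow> real_polynomial_function (D j f)"
  by (simp add: X_polynomial real_polynomial_function_vf_apply)

lemma L_polynomial: "real_polynomial_function f \<Longrightarrow> real_polynomial_function (L f)"
  unfolding sum_of_squares_def [abs_def]
  by (intro real_polynomial_function_sum D_polynomial) auto

lemma L_add:
  assumes "real_polynomial_function f" "real_polynomial_function g"
  shows "L (\<lambda>x. f x + g x) x = L f x + L g x"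
  using assms by (simp add: sum_of_squares_def vf_apply_add D_polynomial sum.distrib)

lemma L_const: "L (\<lambda>x. c) x = 0"
  by (simp add: sum_of_squares_def vf_apply_const)

lemma L_cmult:
  assumes "real_polynomial_function f"
  shows "L (\<lambda>x. c * f x) x = c * L f x"
  using assms by (simp add: sum_of_squares_def vf_apply_cmult D_polynomial sum_distrib_left)

lemma L_diff:
  assumes "real_polynomial_function f" "real_polynomial_function g"
  shows "L (\<lambda>x. f x - g x) x = L f x - L g x"
  using assms by (simp add: sum_of_squares_def vf_apply_diff D_polynomial sum_subtractf)

lemma L_mult:
  assumes "real_polynomial_function f" "real_polynomial_function g"
  shows "L (\<lambda>x. f x * g x) x = f x * L g x + 2 * (\<Sum>j=1..m. D j f x * D j g x) + L f x * g x"
proof -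
  have "D j (D j (\<lambda>x. f x * g x)) x =
      f x * D j (D j g) x + 2 * (D j f x * D j g x) + D j (D j f) x * g x" if "j \<in> {1..m}" for j
    using assms that
    by (simp add: vf_apply_mult vf_apply_add D_polynomial real_polynomial_function_mult)
  then show ?thesis
    by (simp add: sum_of_squares_def sum.distrib sum_distrib_left sum_distrib_right)
qed

text \<open>Where \<open>g\<close> vanishes only the cross terms of the product rule survive. They
  supply the large positive term of the barrier in \<open>peak_tangent\<close>.\<close>

lemma L_power2_at_zero:
  assumes "real_polynomial_function g" "g x = 0"
  shows "L (\<lambda>x. (g x)\<^sup>2) x = 2 * (\<Sum>j=1..m. (D j g x)\<^sup>2)"
  using assms by (simp add: L_mult power2_eq_square)

lemma real_polynomial_function_dilation:
  assumes "real_polynomial_function f"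
  shows "real_polynomial_function (\<lambda>x. f (dilation \<sigma> r x))"
  using real_polynomial_function_compose [OF polynomial_function_bounded_linear
      [OF bounded_linear_dilation] assms] by (simp add: o_def)

text \<open>Each of the two applications of a field contributes one factor \<open>r\<close>; in
  particular rescaling preserves the sign of \<open>L\<close>.\<close>

lemma L_dilation:
  assumes f: "real_polynomial_function f" and r: "r > 0"
  shows "L (\<lambda>x. f (dilation \<sigma> r x)) x = r\<^sup>2 * L f (dilation \<sigma> r x)"
proof -
  have "D j (D j (\<lambda>x. f (dilation \<sigma> r x))) x = r\<^sup>2 * D j (D j f) (dilation \<sigma> r x)"
    if j: "j \<in> {1..m}" for j
  proof -
    have "D j (\<lambda>x. f (dilation \<sigma> r x)) = (\<lambda>x. r * D j f (dilation \<sigma> r x))"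
      using D_dilation [OF j f r] by blast
    moreover have "D j (\<lambda>x. r * D j f (dilation \<sigma> r x)) x = r * D j (\<lambda>x. D j f (dilation \<sigma> r x)) x"
      by (simp only: vf_apply_cmult [OF real_polynomial_function_dilation [OF D_polynomial [OF j f]]])
    ultimately show ?thesis
      by (simp add: D_dilation [OF j D_polynomial [OF j f] r] power2_eq_square)
  qed
  then show ?thesis by (simp add: sum_of_squares_def sum_distrib_left)
qed

section \<open>Polynomial solutions of the Cauchy problem\<close>

text \<open>A nilpotency index: every word of length \<open>n\<close> in the fields annihilates
  \<open>f\<close>. It is the induction measure that makes the solution of the Cauchy problem a
  finite sum.\<close>

primrec killed :: "nat \<Rightarrow> ((real, 'n) vec \<Rightarrow> real) \<Rightarrow> bool" where
  "killed 0 f \<longleftrightarrow> f = (\<lambda>x. 0)"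
| "killed (Suc n) f \<longleftrightarrow> real_polynomial_function f \<and> (\<forall>j\<in>{1..m}. killed n (D j f))"

lemma killed_polynomial: "killed n f \<Longrightarrow> real_polynomial_function f"
  by (cases n) (auto simp: real_polynomial_function_const)

lemma killed_zero: "killed n (\<lambda>x. 0)"
  by (induction n) (auto simp: real_polynomial_function_const vf_apply_const)

lemma killed_Suc: "killed n f \<Longrightarrow> killed (Suc n) f"
  by (induction n arbitrary: f) (auto simp: real_polynomial_function_const vf_apply_const)

lemma killed_mono: "n \<le> n' \<Longrightarrow> killed n f \<Longrightarrow> killed n' f"
  by (induction n' rule: dec_induct) (auto intro: killed_Suc simp del: killed.simps)

lemma killed_add: "killed n f \<Longrightarrow> killed n g \<Longrightarrow> killed n (\<lambda>x. f x + g x)"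
  by (induction n arbitrary: f g) (auto simp: real_polynomial_function_add vf_apply_add)

lemma killed_cmult: "killed n f \<Longrightarrow> killed n (\<lambda>x. c * f x)"
  by (induction n arbitrary: f)
    (auto simp: real_polynomial_function_mult real_polynomial_function_const vf_apply_cmult)

lemma killed_sum:
  "finite I \<Longrightarrow> (\<And>i. i \<in> I \<Longrightarrow> killed n (f i)) \<Longrightarrow> killed n (\<lambda>x. \<Sum>i\<in>I. f i x)"
  by (induction I rule: finite_induct) (auto simp: killed_zero killed_add)

text \<open>Pigeonhole in the Leibniz rule: of \<open>a + b + 1\<close> fields, either more than
  \<open>a\<close> fall on \<open>f\<close> or more than \<open>b\<close> fall on
  \<open>g\<close>.\<close>

lemma killed_mult:
  "killed (Suc a) f \<Longrightarrow> killed (Suc b) g \<Longrightarrow> killed (Suc (a + b)) (\<lambda>x. f x * g x)"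
proof (induction "a + b" arbitrary: a b f g rule: less_induct)
  case less
  have pf: "real_polynomial_function f" and pg: "real_polynomial_function g"
    using less.prems by (auto simp: killed_polynomial)
  have "killed (a + b) (\<lambda>x. f x * D j g x)" if j: "j \<in> {1..m}" for j
  proof (cases b)
    case 0
    then have "D j g = (\<lambda>x. 0)" using less.prems j by simp
    then show ?thesis by (simp add: killed_zero)
  next
    case (Suc b')
    then have "killed (Suc (a + b')) (\<lambda>x. f x * D j g x)"
      using less.prems j by (intro less.hyps) auto
    then show ?thesis by (simp add: Suc)
  qed
  moreover have "killed (a + b) (\<lambda>x. D j f x * g x)" if j: "j \<in> {1..m}" for j
  proof (cases a)
    case 0
    then have "D j f = (\<lambda>x. 0)" using less.prems j by simp
    then show ?thesis by (simp add: killed_zero)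
  next
    case (Suc a')
    then have "killed (Suc (a' + b)) (\<lambda>x. D j f x * g x)"
      using less.prems j by (intro less.hyps) auto
    then show ?thesis by (simp add: Suc)
  qed
  ultimately show ?case
    by (simp add: vf_apply_mult pf pg real_polynomial_function_mult killed_add)
qed

text \<open>Each field lowers the degree of homogeneity by one, and a polynomial of degree 0 is
  constant.\<close>

lemma killed_homogeneous:
  assumes "real_polynomial_function f" "\<And>r x. r > 0 \<Longrightarrow> f (dilation \<sigma> r x) = r ^ k * f x"
  shows "killed (Suc k) f"
  using assms
proof (induction k arbitrary: f)
  case 0
  have "f x = f 0" for x
  proof -
    have "((\<lambda>r. f (dilation \<sigma> r x)) \<longlongrightarrow> f 0) (at_right 0)"
      using sigma_ge_1 0(1) by (intro tendsto_at_dilation_0 continuous_on_real_polynomial_function)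
    moreover have "\<forall>\<^sub>F r in at_right 0. f (dilation \<sigma> r x) = f x"
      using eventually_at_right_less [of 0] by eventually_elim (simp add: 0(2))
    ultimately have "((\<lambda>r::real. f x) \<longlongrightarrow> f 0) (at_right 0)"
      by (rule Lim_transform_eventually)
    then show ?thesis by (simp add: tendsto_const_iff)
  qed
  then have "f = (\<lambda>x. f 0)" by blast
  then have "D j f = (\<lambda>x. 0)" for j by (metis vf_apply_const)
  then show ?case by (simp add: 0)
next
  case (Suc k)
  have "killed (Suc k) (D j f)" if j: "j \<in> {1..m}" for j
  proof (rule Suc.IH)
    show "real_polynomial_function (D j f)" using j Suc.prems(1) by (rule D_polynomial)
    fix r :: real and x assume r: "r > 0"
    have "r * D j f (dilation \<sigma> r x) = D j (\<lambda>x. f (dilation \<sigma> r x)) x"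
      using D_dilation [OF j Suc.prems(1) r] by simp
    also have "\<dots> = r ^ Suc k * D j f x"
      using Suc.prems r by (simp add: vf_apply_cmult)
    finally show "D j f (dilation \<sigma> r x) = r ^ k * D j f x" using r by simp
  qed
  then show ?case using Suc.prems(1) by simp
qed

text \<open>Coordinates are homogeneous of degree \<open>\<sigma> i\<close>, and the property passes
  to sums and products; no decomposition into homogeneous parts is made.\<close>

lemma polynomial_imp_killed:
  assumes "real_polynomial_function f"
  shows "\<exists>n. killed n f"
  using assms
proof (induction f rule: real_polynomial_function.induct)
  case (linear f)
  have "killed (Suc (Max (range \<sigma>))) (\<lambda>x. f (axis i 1) * x $ i)" for i
  proof (rule killed_mono [OF _ killed_cmult])
    show "killed (Suc (\<sigma> i)) (\<lambda>x. x $ i)"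
      by (rule killed_homogeneous) (auto simp: real_polynomial_function_nth)
  qed simp
  then have "killed (Suc (Max (range \<sigma>))) (\<lambda>x. \<Sum>i\<in>UNIV. f (axis i 1) * x $ i)"
    by (intro killed_sum) auto
  moreover have "f = (\<lambda>x. \<Sum>i\<in>UNIV. f (axis i 1) * x $ i)"
  proof
    fix x
    have l: "linear f" using linear by (rule bounded_linear.linear)
    have "f (\<Sum>i\<in>UNIV. x $ i *\<^sub>R axis i 1) = (\<Sum>i\<in>UNIV. f (axis i 1) * x $ i)"
      by (simp add: linear_sum [OF l] linear_cmul [OF l] mult.commute)
    then show "f x = (\<Sum>i\<in>UNIV. f (axis i 1) * x $ i)"
      using basis_expansion [of x] by (simp add: scalar_mult_eq_scaleR)
  qed
  ultimately show ?case by metis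
next
  case (const c)
  have "killed 1 (\<lambda>x. c)" by (simp add: real_polynomial_function_const vf_apply_const)
  then show ?case by blast
next
  case (add f g)
  then obtain a b where "killed a f" "killed b g" by blast
  then have "killed (max a b) (\<lambda>x. f x + g x)"
    using killed_mono [OF max.cobounded1] killed_mono [OF max.cobounded2] killed_add by blast
  then show ?case by blast
next
  case (mult f g)
  then obtain a b where "killed a f" "killed b g" by blast
  then have "killed (Suc (a + b)) (\<lambda>x. f x * g x)"
    by (intro killed_mult killed_Suc)
  then show ?case by blast
qed

section \<open>The first coordinate as a noncharacteristic direction\<close>

definition c0 :: "nat \<Rightarrow> real" where "c0 j = X j 0 $ i0"

text \<open>The principal symbol of \<open>L\<close> at the conormal of the hyperplanes
  \<open>x $ i0 = t\<close>; by \<open>X_i0\<close> it is the same at all points.\<close>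

definition a0 :: real where "a0 = (\<Sum>j=1..m. (c0 j)\<^sup>2)"

text \<open>This coefficient has degree \<open>\<sigma> i0 - 1 = 0\<close>, so it is constant along
  orbits, and these tend to the origin.\<close>

lemma X_i0:
  assumes j: "j \<in> {1..m}"
  shows "X j x $ i0 = c0 j"
proof -
  have "((\<lambda>r. X j (dilation \<sigma> r x) $ i0) \<longlongrightarrow> c0 j) (at_right 0)"
    unfolding c0_def using sigma_ge_1 X_polynomial [OF j, unfolded polynomial_function_iff_nth]
    by (intro tendsto_at_dilation_0 continuous_on_real_polynomial_function) auto
  moreover have "\<forall>\<^sub>F r in at_right 0. X j (dilation \<sigma> r x) $ i0 = X j x $ i0"
    using eventually_at_right_less [of 0]
    by eventually_elim (simp add: X_dilation [OF j] sigma_i0)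
  ultimately have "((\<lambda>r::real. X j x $ i0) \<longlongrightarrow> c0 j) (at_right 0)"
    by (rule Lim_transform_eventually)
  then show ?thesis by (simp add: tendsto_const_iff)
qed

text \<open>Otherwise every generator kills the coordinate \<open>x $ i0\<close>. By the commutator
  formula so does the whole Lie algebra, which contradicts the rank condition at the origin.\<close>

lemma a0_pos: "a0 > 0"
proof (rule ccontr)
  assume "\<not> a0 > 0"
  moreover have "a0 \<ge> 0" unfolding a0_def by (intro sum_nonneg) auto
  ultimately have "a0 = 0" by simp
  then have "c0 j = 0" if "j \<in> {1..m}" for j
    using that by (simp add: a0_def sum_nonneg_eq_0_iff)
  then have X0: "X j x $ i0 = 0" if "j \<in> {1..m}" for j x
    using that X_i0 by metis
  have Y0: "\<forall>x. Y x $ i0 = 0" if "Y \<in> lie_algebra (X ` {1..m})" for Y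
    using that
  proof (induction rule: lie_algebra.induct)
    case (generator Y)
    then show ?case using X0 by blast
  next
    case (bracket Y Z)
    note p = bracket(1,2) [THEN lie_algebra_polynomial]
    have "vf_apply (lie_bracket Y Z) (\<lambda>x. x $ i0) x = 0" for x
      using bracket.IH vf_apply_lie_bracket [OF p real_polynomial_function_nth, of i0 x]
      by (simp add: vf_apply_nth vf_apply_const)
    then show ?case by (simp add: vf_apply_nth)
  qed auto
  have "axis i0 1 \<in> span ((\<lambda>Y. Y 0) ` lie_algebra (X ` {1..m}))"
    unfolding span_lie_algebra by (rule UNIV_I)
  then have "axis i0 (1::real) $ i0 = 0"
  proof (induction rule: span_induct)
    case base
    then show ?case by (auto simp: subspace_def)
  next
    case (step x)
    then show ?case using Y0 by auto
  qed
  then show False by (simp add: axis_def)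
qed

text \<open>The product rule with \<open>D j\<close> of \<open>x $ i0 - t\<close> equal to the
  constant \<open>c0 j\<close>. The right-hand side isolates the leading power \<open>k\<close>;
  everything else has one power more and is passed on to the recursion.\<close>

lemma L_power_mult:
  fixes t :: real
  assumes g: "real_polynomial_function g"
  shows "L (\<lambda>x. (x $ i0 - t) ^ (k + 2) * g x) x =
    real (k + 2) * real (k + 1) * a0 * (x $ i0 - t) ^ k * g x +
    (x $ i0 - t) ^ (k + 1) *
      ((x $ i0 - t) * L g x + 2 * real (k + 2) * (\<Sum>j=1..m. c0 j * D j g x))"
proof -
  define s where "s = (\<lambda>x::(real, 'n) vec. x $ i0 - t)"
  have ps: "real_polynomial_function s"
    unfolding s_def by (intro real_polynomial_function_diff real_polynomial_function_nth
        real_polynomial_function_const)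
  have Ds: "D j s = (\<lambda>x. c0 j)" if "j \<in> {1..m}" for j
    unfolding s_def
    by (simp add: vf_apply_diff vf_apply_nth vf_apply_const real_polynomial_function_nth
        real_polynomial_function_const X_i0 [OF that])
  have D1: "D j (\<lambda>x. s x ^ (k + 2)) = (\<lambda>x. (real (k + 2) * c0 j) * s x ^ (k + 1))"
    if "j \<in> {1..m}" for j
    using vf_apply_power [OF ps, of "X j" "k + 1"] by (simp add: Ds [OF that] mult_ac)
  have D2: "D j (D j (\<lambda>x. s x ^ (k + 2))) x = real (k + 2) * real (k + 1) * (c0 j)\<^sup>2 * s x ^ k"
    if "j \<in> {1..m}" for j
  proof -
    have "D j (\<lambda>x. (real (k + 2) * c0 j) * s x ^ Suc k) x = real (k + 2) * c0 j * D j (\<lambda>x. s x ^ Suc k) x"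
      by (simp only: vf_apply_cmult [OF real_polynomial_function_power [OF ps]])
    also have "D j (\<lambda>x. s x ^ Suc k) x = real (k + 1) * s x ^ k * c0 j"
      by (simp only: vf_apply_power [OF ps] Ds [OF that] of_nat_add of_nat_1)
    finally show ?thesis
      unfolding D1 [OF that] by (simp add: power2_eq_square algebra_simps)
  qed
  have "L (\<lambda>x. s x ^ (k + 2)) x = real (k + 2) * real (k + 1) * a0 * s x ^ k"
    unfolding a0_def sum_of_squares_def by (simp only: D2 sum_distrib_left sum_distrib_right cong: sum.cong)
  moreover have "(\<Sum>j=1..m. D j (\<lambda>x. s x ^ (k + 2)) x * D j g x) =
      real (k + 2) * s x ^ (k + 1) * (\<Sum>j=1..m. c0 j * D j g x)"
    unfolding sum_distrib_left by (rule sum.cong) (simp_all only: D1 mult_ac)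
  ultimately have "L (\<lambda>x. s x ^ (k + 2) * g x) x = s x ^ (k + 2) * L g x
      + 2 * (real (k + 2) * s x ^ (k + 1) * (\<Sum>j=1..m. c0 j * D j g x))
      + real (k + 2) * real (k + 1) * a0 * s x ^ k * g x"
    using L_mult [OF real_polynomial_function_power [OF ps, of "k + 2"] g, of x] by simp
  then show ?thesis by (simp add: s_def algebra_simps)
qed

text \<open>The hyperplanes on which the first coordinate is constant are noncharacteristic for L.  Each
  step of the iteration trades one field for one power of the first coordinate.\<close>

lemma exists_polynomial_solution_power:
  assumes "killed n g"
  shows "\<exists>W. real_polynomial_function W \<and>
    (\<forall>x. L (\<lambda>x. (x $ i0 - t) ^ (k + 2) * W x) x = (x $ i0 - t) ^ k * g x)"
  using assms
proof (induction n arbitrary: g k)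
  case 0
  then show ?case
    by (intro exI [of _ "\<lambda>x. 0"]) (simp add: real_polynomial_function_const L_const)
next
  case (Suc n)
  have pg: "real_polynomial_function g" using Suc.prems by (rule killed_polynomial)
  define c where "c = real (k + 2) * real (k + 1) * a0"
  have c: "c > 0" unfolding c_def using a0_pos by (intro mult_pos_pos) (auto intro: add_pos_nonneg)
  \<comment> \<open>The first guess \<open>g / c\<close> solves the equation up to
    \<open>(x $ i0 - t) ^ (k + 1) * g'\<close>. The induction hypothesis at \<open>k + 1\<close>
    removes this remainder, whence the form of \<open>W\<close> below.\<close>
  define g' where "g' = (\<lambda>x. (1 / c) *
    ((x $ i0 - t) * L g x + 2 * real (k + 2) * (\<Sum>j=1..m. c0 j * D j g x)))"
  have kD: "killed n (D j g)" if "j \<in> {1..m}" for j using Suc.prems that by simp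
  have ks: "killed 2 (\<lambda>x. x $ i0 - t)"
  proof -
    have "D j (\<lambda>x. x $ i0 - t) = (\<lambda>x. c0 j)" if "j \<in> {1..m}" for j
      by (simp add: vf_apply_diff vf_apply_nth vf_apply_const real_polynomial_function_nth
        real_polynomial_function_const X_i0 [OF that])
    then show ?thesis
      by (auto simp: numeral_2_eq_2 vf_apply_const real_polynomial_function_const
          intro!: real_polynomial_function_diff real_polynomial_function_nth)
  qed
  \<comment> \<open>\<open>L\<close> lowers the index by two and the factor
    \<open>x $ i0 - t\<close> raises it by one, a net gain of one. For \<open>n < 2\<close> the
    index \<open>n - 1\<close> of \<open>L g\<close> leaves no room for \<open>killed_mult\<close>,
    but then \<open>L g\<close> is zero.\<close>
  have "killed n (\<lambda>x. (x $ i0 - t) * L g x)"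
  proof (cases "n < 2")
    case True
    have "D j (D j g) = (\<lambda>x. 0)" if "j \<in> {1..m}" for j
      using kD [OF that] True that
      by (cases n) (auto simp: vf_apply_const less_Suc_eq numeral_2_eq_2)
    then have "L g x = 0" for x by (simp add: sum_of_squares_def)
    then show ?thesis by (simp add: killed_zero)
  next
    case False
    then obtain n' where n: "n = Suc (Suc n')" by (metis add_2_eq_Suc le_Suc_ex not_less)
    have "killed (Suc n') (\<lambda>x. \<Sum>j=1..m. D j (D j g) x)"
      using kD n by (intro killed_sum) auto
    then have "killed (Suc n') (L g)" by (simp add: sum_of_squares_def [abs_def])
    from killed_mult [OF ks [unfolded numeral_2_eq_2] this] show ?thesis by (simp add: n)
  qed
  moreover have "killed n (\<lambda>x. 2 * real (k + 2) * (\<Sum>j=1..m. c0 j * D j g x))"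
    using kD by (intro killed_cmult killed_sum) auto
  ultimately have "killed n g'" unfolding g'_def by (rule killed_cmult [OF killed_add])
  from Suc.IH [OF this, of "k + 1"] obtain W' where pW': "real_polynomial_function W'"
    and W': "\<And>x. L (\<lambda>x. (x $ i0 - t) ^ (k + 3) * W' x) x = (x $ i0 - t) ^ (k + 1) * g' x"
    by (auto simp: numeral_3_eq_3)
  define W where "W = (\<lambda>x. (1 / c) * g x - (x $ i0 - t) * W' x)"
  have ps: "real_polynomial_function (\<lambda>x. x $ i0 - t)" using ks by (rule killed_polynomial)
  have pc: "real_polynomial_function (\<lambda>x. (1 / c) * g x)"
    by (intro real_polynomial_function_mult real_polynomial_function_const pg)
  have "real_polynomial_function W"
    unfolding W_def
    by (intro real_polynomial_function_diff real_polynomial_function_mult pc ps pW')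
  moreover have "L (\<lambda>x. (x $ i0 - t) ^ (k + 2) * W x) x = (x $ i0 - t) ^ k * g x" for x
  proof -
    have e: "(\<lambda>x. (x $ i0 - t) ^ (k + 2) * W x) =
        (\<lambda>x. (1 / c) * ((x $ i0 - t) ^ (k + 2) * g x) - (x $ i0 - t) ^ (k + 3) * W' x)"
      by (auto simp: W_def fun_eq_iff algebra_simps numeral_3_eq_3)
    have p1: "real_polynomial_function (\<lambda>x. (x $ i0 - t) ^ (k + 2) * g x)"
      by (intro real_polynomial_function_mult real_polynomial_function_power ps pg)
    have p2: "real_polynomial_function (\<lambda>x. (x $ i0 - t) ^ (k + 3) * W' x)"
      by (intro real_polynomial_function_mult real_polynomial_function_power ps pW')
    have "L (\<lambda>x. (x $ i0 - t) ^ (k + 2) * W x) x =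
        (1 / c) * L (\<lambda>x. (x $ i0 - t) ^ (k + 2) * g x) x - (x $ i0 - t) ^ (k + 1) * g' x"
      unfolding e W' [symmetric]
      by (simp only: L_diff [OF real_polynomial_function_mult [OF real_polynomial_function_const p1] p2]
          L_cmult [OF p1])
    also have "\<dots> = (x $ i0 - t) ^ k * g x"
      unfolding L_power_mult [OF pg] g'_def c_def [symmetric] using c by (simp add: field_simps)
    finally show ?thesis .
  qed
  ultimately show ?case by blast
qed

text \<open>On the hyperplane only the leading term of \<open>L_power_mult\<close> survives. This
  gives the last conclusion, from which the sign of \<open>W\<close> is read off.\<close>

lemma exists_polynomial_solution:
  assumes p: "real_polynomial_function p"
  obtains W where "real_polynomial_function W"
    "\<And>x. L (\<lambda>x. (x $ i0 - t)\<^sup>2 * W x) x = p x"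
    "\<And>x. x $ i0 = t \<Longrightarrow> p x = 2 * a0 * W x"
proof -
  obtain n where "killed n p" using polynomial_imp_killed [OF p] by blast
  from exists_polynomial_solution_power [OF this, of t 0] obtain W
    where W: "real_polynomial_function W" "\<And>x. L (\<lambda>x. (x $ i0 - t)\<^sup>2 * W x) x = p x"
    by (auto simp: power2_eq_square)
  moreover have "p x = 2 * a0 * W x" if "x $ i0 = t" for x
    using L_power_mult [OF W(1), of t 0 x] W(2) [of x] that by (simp add: power2_eq_square)
  ultimately show thesis using that by blast
qed

section \<open>Subharmonic functions as viscosity subsolutions\<close>

lemma harmonic_on_polynomial:
  assumes "real_polynomial_function h" "\<And>x. L h x = 0"
  shows "harmonic_on L S h"
  using assms by (simp add: harmonic_on_def smooth_on_real_polynomial_function)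

text \<open>This viscosity inequality is the form in which subharmonicity enters the barrier
  argument.\<close>

lemma subharmonic_on_test_function:
  assumes u: "subharmonic_on L \<Omega> u" and \<rho>: "\<rho> > 0" "ball z \<rho> \<subseteq> \<Omega>"
    and \<phi>: "real_polynomial_function \<phi>" "u z = ereal (\<phi> z)"
    and le: "\<And>x. x \<in> ball z \<rho> \<Longrightarrow> u x \<le> ereal (\<phi> x)"
  shows "L \<phi> z \<ge> 0"
proof (rule ccontr)
  assume "\<not> L \<phi> z \<ge> 0"
  then have neg: "L \<phi> z < 0" by simp
  define N where "N = (\<lambda>x. (norm (x - z))\<^sup>2)"
  have pN: "real_polynomial_function N"
    unfolding N_def by (rule real_polynomial_function_norm_diff_power2)
  \<comment> \<open>The penalty \<open>\<eta> * N\<close> uses up at most half of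
    \<open>- L \<phi> z\<close>, so \<open>L q z\<close> stays negative, while \<open>q\<close>
    exceeds \<open>\<phi>\<close> by \<open>\<eta> * r^2\<close> on the sphere of radius
    \<open>r\<close>.\<close>
  define \<eta> where "\<eta> = - L \<phi> z / (2 * (\<bar>L N z\<bar> + 1))"
  have \<eta>: "\<eta> > 0" using neg by (simp add: \<eta>_def divide_neg_pos)
  have small: "\<eta> * L N z < - L \<phi> z"
  proof -
    have "\<eta> * L N z \<le> \<eta> * (\<bar>L N z\<bar> + 1)" using \<eta> by (intro mult_left_mono) auto
    also have "\<dots> = - L \<phi> z / 2" by (simp add: \<eta>_def field_simps)
    finally show ?thesis using neg by simp
  qed
  define q where "q = (\<lambda>x. \<phi> x + \<eta> * N x)"
  have pq: "real_polynomial_function q"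
    unfolding q_def by (intro real_polynomial_function_add real_polynomial_function_mult
        real_polynomial_function_const pN \<phi>)
  have Lq: "L q z < 0"
    unfolding q_def using small \<phi>(1) pN
    by (simp add: L_add L_cmult real_polynomial_function_mult real_polynomial_function_const)
  obtain W where pW: "real_polynomial_function W"
    and LW: "\<And>x. L (\<lambda>x. (x $ i0 - z $ i0)\<^sup>2 * W x) x = - L q x"
    and Wz: "\<And>x. x $ i0 = z $ i0 \<Longrightarrow> - L q x = 2 * a0 * W x"
    using exists_polynomial_solution [of "\<lambda>x. - L q x" "z $ i0"] L_polynomial [OF pq]
      real_polynomial_function_minus by blast
  have "a0 * W z > 0" using Wz [of z] Lq by linarith
  then have "W z > 0" using a0_pos by (rule zero_less_mult_pos)
  moreover have "isCont W z" using pW by (rule continuous_real_polymonial_function)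
  ultimately have "\<forall>\<^sub>F x in at z. W x > 0"
    unfolding isCont_def by (rule order_tendstoD(1) [rotated])
  then obtain \<delta> where \<delta>: "\<delta> > 0" "\<And>x. x \<noteq> z \<Longrightarrow> dist x z < \<delta> \<Longrightarrow> W x > 0"
    unfolding eventually_at by blast
  define r where "r = min \<rho> \<delta> / 2"
  have r: "r > 0" "r < \<rho>" "r < \<delta>" using \<rho>(1) \<delta>(1) by (auto simp: r_def min_def)
  \<comment> \<open>The term with \<open>W\<close> makes \<open>h\<close> harmonic, vanishes at
    \<open>z\<close> and is nonnegative on the small ball. Subtracting the gain of the penalty keeps
    \<open>h\<close> above \<open>\<phi>\<close> on the sphere but puts it strictly below
    \<open>\<phi>\<close> at \<open>z\<close>.\<close>
  define h where "h = (\<lambda>x. (q x + (x $ i0 - z $ i0)\<^sup>2 * W x) - \<eta> * r\<^sup>2)"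
  have ps: "real_polynomial_function (\<lambda>x. (x $ i0 - z $ i0)\<^sup>2 * W x)"
    by (intro real_polynomial_function_mult real_polynomial_function_power
        real_polynomial_function_diff real_polynomial_function_nth real_polynomial_function_const pW)
  have ph: "real_polynomial_function h"
    unfolding h_def by (intro real_polynomial_function_diff real_polynomial_function_add
        real_polynomial_function_const pq ps)
  have Lh: "L h x = 0" for x
    unfolding h_def
    using pq ps by (simp add: L_diff L_add L_const LW real_polynomial_function_add
        real_polynomial_function_const)
  have "u x \<le> ereal (h x)" if "x \<in> frontier (ball z r)" for x
  proof -
    have d: "dist z x = r" using that r by (simp add: frontier_ball)
    then have "u x \<le> ereal (\<phi> x)" using r by (intro le) simp
    moreover have "0 \<le> (x $ i0 - z $ i0)\<^sup>2 * W x"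
    proof (rule mult_nonneg_nonneg)
      show "W x \<ge> 0" using \<delta>(2) [of x] d r by (force simp: dist_commute)
    qed simp
    then have "\<phi> x \<le> h x"
      using d by (simp add: h_def q_def N_def dist_norm norm_minus_commute)
    ultimately show ?thesis using order_trans ereal_less_eq(3) by blast
  qed
  moreover have "closure (ball z r) \<subseteq> \<Omega>" using r \<rho>(2) by (auto simp: subset_iff)
  moreover have "harmonic_on L (ball z r) h" using ph Lh by (rule harmonic_on_polynomial)
  moreover have "continuous_on (closure (ball z r)) h"
    using ph by (rule continuous_on_real_polynomial_function)
  ultimately have "\<forall>x\<in>ball z r. u x \<le> ereal (h x)"
    using u unfolding subharmonic_on_def by blast
  then have "u z \<le> ereal (h z)" using r by simp
  then have "\<phi> z \<le> \<phi> z - \<eta> * r\<^sup>2" using \<phi>(2) by (simp add: h_def q_def N_def)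
  then show False using \<eta> r by (simp add: zero_less_mult_iff mult_le_0_iff)
qed

end


section \<open>Closed sets to which vector fields are tangent\<close>

text \<open>Orthogonality to the outer normals of \<open>F\<close> in the sense of Bony: the
  gradient at \<open>x\<close> of a function with a local maximum over \<open>F\<close> at
  \<open>x\<close> is such a normal. The equality covers the flows of both \<open>Z\<close> and
  \<open>-Z\<close>.\<close>

definition tangent_field :: "(real^'n) set \<Rightarrow> (real^'n \<Rightarrow> real^'n) \<Rightarrow> bool" where
  "tangent_field F Z \<longleftrightarrow> polynomial_function Z \<and>
     (\<forall>f x r. real_polynomial_function f \<longrightarrow> x \<in> F \<longrightarrow> r > 0 \<longrightarrow>
        (\<forall>y\<in>F \<inter> ball x r. f y \<le> f x) \<longrightarrow> vf_apply Z f x = 0)"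

lemma tangent_fieldD:
  assumes "tangent_field F Z" "real_polynomial_function f" "x \<in> F" "r > 0"
    "\<And>y. y \<in> F \<Longrightarrow> y \<in> ball x r \<Longrightarrow> f y \<le> f x"
  shows "vf_apply Z f x = 0"
  using assms unfolding tangent_field_def by blast

lemma tangent_field_polynomial: "tangent_field F Z \<Longrightarrow> polynomial_function Z"
  by (simp add: tangent_field_def)

lemma tangent_field_scale:
  "tangent_field F Z \<Longrightarrow> tangent_field F (\<lambda>x. c *\<^sub>R Z x)"
  by (auto simp: tangent_field_def vf_apply_field_scale)

lemma tangent_field_zero: "tangent_field F (\<lambda>x. 0)"
  by (auto simp: tangent_field_def vf_apply_field_zero)

lemma tangent_field_add:
  assumes "tangent_field F Y" "tangent_field F Z"
  shows "tangent_field F (\<lambda>x. Y x + Z x)"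
  unfolding tangent_field_def
proof (intro conjI allI impI)
  show "polynomial_function (\<lambda>x. Y x + Z x)"
    using assms by (auto simp: tangent_field_def)
  fix f x and r :: real
  assume "real_polynomial_function f" "x \<in> F" "r > 0" "\<forall>y\<in>F \<inter> ball x r. f y \<le> f x"
  then show "vf_apply (\<lambda>x. Y x + Z x) f x = 0"
    using tangent_fieldD [OF assms(1), of f x r] tangent_fieldD [OF assms(2), of f x r]
    by (simp add: vf_apply_field_add)
qed

section \<open>Discretised flows and tangency of brackets\<close>

lemma bounded_real_polynomial_function:
  fixes K :: "'a::euclidean_space set"
  assumes "compact K" "real_polynomial_function f"
  shows "\<exists>B\<ge>0. \<forall>x\<in>K. \<bar>f x\<bar> \<le> B"
proof -
  have "bounded (f ` K)"
    using assms by (intro compact_imp_bounded compact_continuous_image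
        continuous_on_real_polynomial_function)
  then obtain B where "\<forall>x\<in>K. \<bar>f x\<bar> \<le> B" by (auto simp: bounded_iff)
  then show ?thesis by (metis abs_ge_zero abs_of_nonneg linorder_le_cases order_trans)
qed

lemma bounded_real_polynomial_functions:
  fixes K :: "'a::euclidean_space set"
  assumes "compact K" "\<And>f. f \<in> set fs \<Longrightarrow> real_polynomial_function f"
  shows "\<exists>B\<ge>0. \<forall>f\<in>set fs. \<forall>x\<in>K. \<bar>f x\<bar> \<le> B"
  using assms(2)
proof (induction fs)
  case (Cons f fs)
  then obtain B where B: "B \<ge> 0" "\<forall>f\<in>set fs. \<forall>x\<in>K. \<bar>f x\<bar> \<le> B" by auto
  obtain B' where B': "B' \<ge> 0" "\<forall>x\<in>K. \<bar>f x\<bar> \<le> B'"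
    using bounded_real_polynomial_function [OF assms(1)] Cons.prems by (metis list.set_intros(1))
  show ?case
  proof (intro exI conjI)
    show "\<forall>g\<in>set (f # fs). \<forall>x\<in>K. \<bar>g x\<bar> \<le> max B B'" using B B' by fastforce
  qed (use B in auto)
qed auto

lemma abs_mult_le_of_abs_le_1:
  fixes a b :: real
  assumes "\<bar>a\<bar> \<le> 1" "\<bar>b\<bar> \<le> B"
  shows "\<bar>a * b\<bar> \<le> B"
  using mult_mono [OF assms] by (simp add: abs_mult)

lemma abs_add_le_add:
  fixes a b :: real
  shows "\<bar>a\<bar> \<le> A \<Longrightarrow> \<bar>b\<bar> \<le> B \<Longrightarrow> \<bar>a + b\<bar> \<le> A + B"
  by linarith

text \<open>The right-hand side is f0 + t f1 + t^2 f2 up to third order, and the left-hand side is its second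
  order expansion along the flow of Z.  A maximum over F does not notice the flow, because Z kills
  the function at its interior maximum points; only the error of the expansion survives.\<close>

lemma flow_step:
  fixes F :: "(real^'n) set"
  assumes F: "closed F" "x0 \<in> F" and Z: "tangent_field F Z" and r: "r > 0"
    and p: "real_polynomial_function f0" "real_polynomial_function f1" "real_polynomial_function f2"
    and strict: "\<And>y. y \<in> F \<Longrightarrow> dist x0 y = r \<Longrightarrow> f0 y < f0 x0"
  shows "\<exists>C. \<forall>\<^sub>F t in at_right 0. \<forall>x\<in>F \<inter> cball x0 r. \<exists>y\<in>F \<inter> cball x0 r.
    f0 x + t * (f1 x + vf_apply Z f0 x) +
      t\<^sup>2 * (f2 x + vf_apply Z f1 x + vf_apply Z (vf_apply Z f0) x / 2)
    \<le> f0 y + t * f1 y + t\<^sup>2 * f2 y + C * t ^ 3"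
proof -
  define K where "K = F \<inter> cball x0 r"
  have K: "compact K" "x0 \<in> K"
    using F r by (auto simp: K_def intro!: closed_Int_compact)
  define z0 z1 z2 zz0 zz1 zzz0 where zs: "z0 = vf_apply Z f0" "z1 = vf_apply Z f1" "z2 = vf_apply Z f2"
    "zz0 = vf_apply Z z0" "zz1 = vf_apply Z z1" "zzz0 = vf_apply Z zz0"
  have pz: "real_polynomial_function z0" "real_polynomial_function z1" "real_polynomial_function z2"
    "real_polynomial_function zz0" "real_polynomial_function zz1" "real_polynomial_function zzz0"
    unfolding zs using p tangent_field_polynomial [OF Z]
    by (simp_all add: real_polynomial_function_vf_apply)
  have "\<And>f. f \<in> set [f1, f2, z0, z1, z2, zz0, zz1, zzz0] \<Longrightarrow> real_polynomial_function f"
    using p pz by auto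
  from bounded_real_polynomial_functions [OF K(1) this] obtain B where B0: "B \<ge> 0" and
    "\<forall>f\<in>set [f1, f2, z0, z1, z2, zz0, zz1, zzz0]. \<forall>x\<in>K. \<bar>f x\<bar> \<le> B"
    by blast
  then have B: "\<bar>f1 x\<bar> \<le> B" "\<bar>f2 x\<bar> \<le> B" "\<bar>z0 x\<bar> \<le> B" "\<bar>z1 x\<bar> \<le> B" "\<bar>z2 x\<bar> \<le> B"
    "\<bar>zz0 x\<bar> \<le> B" "\<bar>zz1 x\<bar> \<le> B" "\<bar>zzz0 x\<bar> \<le> B" if "x \<in> K" for x
    using that by auto
  \<comment> \<open>The expansion to order \<open>t^2\<close> of \<open>f0 + t f1 + t^2 f2\<close>
    transported along \<open>Z\<close> for the time \<open>s * t\<close>; the two sides of the claim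
    are \<open>s = 1\<close> and \<open>s = 0\<close>.\<close>
  define G where "G t s x = f0 x + t * (f1 x + s * z0 x) + t\<^sup>2 * (f2 x + s * z1 x + s\<^sup>2 / 2 * zz0 x)"
    for t s x
  have pG: "real_polynomial_function (G t s)" for t s
    unfolding G_def [abs_def]
    by (intro real_polynomial_function_add real_polynomial_function_mult real_polynomial_function_const p pz)
  have ZG: "vf_apply Z (G t s) x =
      z0 x + t * (z1 x + s * zz0 x) + t\<^sup>2 * (z2 x + s * zz1 x + s\<^sup>2 / 2 * zzz0 x)" for t s x
  proof -
    have "real_polynomial_function (\<lambda>x. t * (f1 x + s * z0 x))"
      "real_polynomial_function (\<lambda>x. f1 x + s * z0 x)"
      "real_polynomial_function (\<lambda>x. s * z0 x)"
      "real_polynomial_function (\<lambda>x. f0 x + t * (f1 x + s * z0 x))"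
      "real_polynomial_function (\<lambda>x. t\<^sup>2 * (f2 x + s * z1 x + s\<^sup>2 / 2 * zz0 x))"
      "real_polynomial_function (\<lambda>x. f2 x + s * z1 x + s\<^sup>2 / 2 * zz0 x)"
      "real_polynomial_function (\<lambda>x. f2 x + s * z1 x)"
      "real_polynomial_function (\<lambda>x. s * z1 x)"
      "real_polynomial_function (\<lambda>x. s\<^sup>2 / 2 * zz0 x)"
      by (intro real_polynomial_function_add real_polynomial_function_mult
          real_polynomial_function_const p pz)+
    then show ?thesis
      unfolding G_def [abs_def]
      by (simp only: vf_apply_add vf_apply_cmult p pz zs [symmetric])
  qed
  \<comment> \<open>A uniform gap on the sphere, by compactness. It keeps the maximum points of
    \<open>G t s\<close> off the sphere, where tangency could not be applied.\<close>
  obtain \<kappa> where \<kappa>: "\<kappa> > 0" "\<And>y. y \<in> F \<Longrightarrow> dist x0 y = r \<Longrightarrow> f0 y \<le> f0 x0 - \<kappa>"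
  proof (cases "F \<inter> sphere x0 r = {}")
    case True
    show thesis
      by (rule that [of 1]) (use True in \<open>auto simp: disjoint_iff\<close>)
  next
    case False
    have "compact (F \<inter> sphere x0 r)" using F by (intro closed_Int_compact) auto
    from continuous_attains_sup [OF this False continuous_on_real_polynomial_function [OF p(1)]]
    obtain y where y: "y \<in> F" "dist x0 y = r" and sup: "\<forall>x\<in>F \<inter> sphere x0 r. f0 x \<le> f0 y" by auto
    show thesis using that [of "f0 x0 - f0 y"] strict [OF y] sup by force
  qed
  have close: "\<bar>G t s x - f0 x\<bar> \<le> 5 * B * t" if "0 \<le> t" "t \<le> 1" "0 \<le> s" "s \<le> 1" "x \<in> K" for t s x
  proof -
    have "s\<^sup>2 \<le> 1" using that by (simp add: power_le_one)
    then have "\<bar>s\<bar> \<le> 1" "\<bar>s\<^sup>2 / 2\<bar> \<le> 1" using that by simp_all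
    then have "\<bar>s * z0 x\<bar> \<le> B" "\<bar>s * z1 x\<bar> \<le> B" "\<bar>s\<^sup>2 / 2 * zz0 x\<bar> \<le> B"
      using B [OF that(5)] by (simp_all only: abs_mult_le_of_abs_le_1)
    then have "\<bar>f1 x + s * z0 x\<bar> \<le> B + B" "\<bar>f2 x + s * z1 x + s\<^sup>2 / 2 * zz0 x\<bar> \<le> B + B + B"
      using B [OF that(5)] by (simp_all only: abs_add_le_add)
    then have 1: "\<bar>f1 x + s * z0 x\<bar> \<le> 2 * B" "\<bar>f2 x + s * z1 x + s\<^sup>2 / 2 * zz0 x\<bar> \<le> 3 * B"
      by simp_all
    have "t\<^sup>2 \<le> t" using that by (simp add: power2_eq_square mult_left_le)
    have "\<bar>t * (f1 x + s * z0 x)\<bar> \<le> t * (2 * B)"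
      unfolding abs_mult using that 1 B0 by (intro mult_mono) auto
    moreover have "\<bar>t\<^sup>2 * (f2 x + s * z1 x + s\<^sup>2 / 2 * zz0 x)\<bar> \<le> t * (3 * B)"
      unfolding abs_mult using that 1 B0 \<open>t\<^sup>2 \<le> t\<close> by (intro mult_mono) auto
    moreover have "G t s x - f0 x = t * (f1 x + s * z0 x) + t\<^sup>2 * (f2 x + s * z1 x + s\<^sup>2 / 2 * zz0 x)"
      by (simp add: G_def)
    ultimately have "\<bar>G t s x - f0 x\<bar> \<le> t * (2 * B) + t * (3 * B)" by (simp only: abs_add_le_add)
    then show ?thesis by (simp add: mult_ac)
  qed
  \<comment> \<open>This gives \<open>10 * B * t < \<kappa>\<close>: by \<open>close\<close>,
    passing from \<open>f0\<close> to \<open>G t s\<close> costs \<open>5 * B * t\<close> at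
    \<open>x0\<close> and as much at a point of the sphere.\<close>
  define t0 where "t0 = min 1 (\<kappa> / (20 * (B + 1)))"
  have t0: "t0 > 0" "t0 \<le> 1" using \<kappa>(1) B0 by (auto simp: t0_def)
  have step: "\<forall>x\<in>K. \<exists>y\<in>K. G t s x \<le> G t (s - d) y + 3 * B * t ^ 3 * d + B * t\<^sup>2 * d\<^sup>2"
    if t: "0 < t" "t < t0" and s: "0 \<le> s" "s \<le> 1" and d: "d \<ge> 0" for t s d
  proof -
    obtain y where y: "y \<in> K" and max: "\<And>x. x \<in> K \<Longrightarrow> G t s x \<le> G t s y"
      using continuous_attains_sup [OF K(1) _ continuous_on_real_polynomial_function [OF pG, of _ t s]] K
      by blast
    have "t * (20 * (B + 1)) < \<kappa>"
      using t B0 by (simp add: t0_def pos_less_divide_eq)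
    moreover have "t * (20 * (B + 1)) = 20 * t + 20 * (B * t)" by (simp add: algebra_simps)
    moreover have "B * t \<ge> 0" using t(1) B0 by simp
    ultimately have small: "10 * B * t < \<kappa>" using t(1) by linarith
    have "dist x0 y \<noteq> r"
    proof
      assume "dist x0 y = r"
      then have "f0 y \<le> f0 x0 - \<kappa>" using \<kappa>(2) y by (auto simp: K_def)
      moreover have "\<bar>G t s x0 - f0 x0\<bar> \<le> 5 * B * t" "\<bar>G t s y - f0 y\<bar> \<le> 5 * B * t"
        using t t0 s y K by (auto intro!: close)
      ultimately show False using max [OF K(2)] small by linarith
    qed
    then have dy: "dist x0 y < r" using y by (auto simp: K_def)
    have "vf_apply Z (G t s) y = 0"
    proof (rule tangent_fieldD [OF Z pG])
      show "y \<in> F" using y by (simp add: K_def)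
      show "r - dist x0 y > 0" using dy by simp
      fix x assume "x \<in> F" "x \<in> ball y (r - dist x0 y)"
      then have "x \<in> K" using dist_triangle [of x0 x y] by (simp add: K_def)
      then show "G t s x \<le> G t s y" by (rule max)
    qed
    \<comment> \<open>The left-hand side times \<open>t\<close> is the derivative of
      \<open>G t s y\<close> in \<open>s\<close>. At the maximum point it is thus of order
      \<open>t^3\<close>; since \<open>G\<close> is quadratic in \<open>s\<close>, the only other
      error is the one with \<open>d^2\<close>.\<close>
    then have z: "z0 y + t * (z1 y + s * zz0 y) = - (t\<^sup>2 * (z2 y + s * zz1 y + s\<^sup>2 / 2 * zzz0 y))"
      unfolding ZG by linarith
    have "G t s y - G t (s - d) y = d * t * (z0 y + t * (z1 y + s * zz0 y)) - t\<^sup>2 * d\<^sup>2 / 2 * zz0 y"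
      by (simp add: G_def power2_eq_square field_simps)
    also have "\<dots> = - (d * t ^ 3 * (z2 y + s * zz1 y + s\<^sup>2 / 2 * zzz0 y)) - t\<^sup>2 * d\<^sup>2 / 2 * zz0 y"
      unfolding z by (simp add: power2_eq_square power3_eq_cube)
    also have "\<dots> \<le> d * t ^ 3 * (3 * B) + t\<^sup>2 * d\<^sup>2 * B"
    proof -
      have "s\<^sup>2 \<le> 1" using s by (simp add: power_le_one)
      then have "\<bar>s\<bar> \<le> 1" "\<bar>s\<^sup>2 / 2\<bar> \<le> 1" using s by simp_all
      then have "\<bar>s * zz1 y\<bar> \<le> B" "\<bar>s\<^sup>2 / 2 * zzz0 y\<bar> \<le> B"
        using B [OF y] by (simp_all only: abs_mult_le_of_abs_le_1)
      then have "\<bar>z2 y + s * zz1 y + s\<^sup>2 / 2 * zzz0 y\<bar> \<le> B + B + B"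
        using B [OF y] by (simp only: abs_add_le_add)
      then have "\<bar>z2 y + s * zz1 y + s\<^sup>2 / 2 * zzz0 y\<bar> \<le> 3 * B" by simp
      then have "\<bar>d * t ^ 3 * (z2 y + s * zz1 y + s\<^sup>2 / 2 * zzz0 y)\<bar> \<le> d * t ^ 3 * (3 * B)"
        unfolding abs_mult using d t B0 by (intro mult_mono) auto
      moreover have "\<bar>t\<^sup>2 * d\<^sup>2 / 2 * zz0 y\<bar> \<le> t\<^sup>2 * d\<^sup>2 * B"
        unfolding abs_mult using B [OF y] by (intro mult_mono) auto
      ultimately show ?thesis by linarith
    qed
    finally have "G t s y \<le> G t (s - d) y + 3 * B * t ^ 3 * d + B * t\<^sup>2 * d\<^sup>2"
      by (simp add: mult_ac)
    with y max show ?thesis by (meson order_trans)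
  qed
  have "\<forall>x\<in>K. \<exists>y\<in>K. G t 1 x \<le> G t 0 y + 4 * B * t ^ 3" if t: "0 < t" "t < t0" for t
  proof -
    \<comment> \<open>With \<open>n\<close> steps of length \<open>1 / n\<close> the quadratic
      errors add up to \<open>B * t^2 / n\<close>, which is below \<open>B * t^3\<close>.\<close>
    obtain n :: nat where n: "1 / t < n" using reals_Archimedean2 by blast
    then have n0: "n > 0" using t by (auto intro: gr0I)
    define e where "e = 3 * B * t ^ 3 * (1 / n) + B * t\<^sup>2 * (1 / n)\<^sup>2"
    have iter: "\<forall>x\<in>K. \<exists>y\<in>K. G t (k / n) x \<le> G t 0 y + k * e" if "k \<le> n" for k
      using that
    proof (induction k)
      case 0
      then show ?case by auto
    next
      case (Suc k)
      show ?case
      proof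
        fix x assume x: "x \<in> K"
        have "0 \<le> real (Suc k) / n" "real (Suc k) / n \<le> 1" using Suc.prems n0 by auto
        from step [OF t this, of "1 / n"] x obtain y where
          y: "y \<in> K" "G t (real (Suc k) / n) x \<le> G t (real (Suc k) / n - 1 / n) y + e"
          unfolding e_def by (auto simp: add.assoc)
        have "real (Suc k) / n - 1 / n = k / n" by (simp add: add_divide_distrib)
        moreover obtain y' where "y' \<in> K" "G t (k / n) y \<le> G t 0 y' + k * e"
          using Suc y(1) by auto
        ultimately show "\<exists>y\<in>K. G t (real (Suc k) / n) x \<le> G t 0 y + real (Suc k) * e"
          using y(2) by (auto simp: algebra_simps intro!: bexI [of _ y'])
      qed
    qed
    have "n * e = 3 * B * t ^ 3 + B * t\<^sup>2 * (1 / n)"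
      using n0 by (simp add: e_def power2_eq_square field_simps)
    also have "\<dots> \<le> 3 * B * t ^ 3 + B * t\<^sup>2 * t"
      using n n0 t B0 by (intro add_left_mono mult_left_mono) (auto simp: field_simps)
    also have "\<dots> = 4 * B * t ^ 3" by (simp add: power2_eq_square power3_eq_cube)
    finally have ne: "n * e \<le> 4 * B * t ^ 3" .
    show ?thesis
    proof
      fix x assume "x \<in> K"
      then obtain y where "y \<in> K" "G t 1 x \<le> G t 0 y + n * e" using iter [of n] n0 by auto
      then show "\<exists>y\<in>K. G t 1 x \<le> G t 0 y + 4 * B * t ^ 3"
        using ne by (intro bexI [of _ y]) auto
    qed
  qed
  then have "\<forall>\<^sub>F t in at_right 0. \<forall>x\<in>K. \<exists>y\<in>K. G t 1 x \<le> G t 0 y + 4 * B * t ^ 3"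
    using t0(1) by (auto simp: eventually_at_right_field)
  then show ?thesis
    unfolding G_def K_def zs by (intro exI [of _ "4 * B"]) simp
qed

text \<open>The third order errors of the four flows along X, Y, -X, -Y are dominated by the second order
  term of their composition, which is the commutator.\<close>

lemma tangent_field_commutator_le:
  fixes F :: "(real^'n) set"
  assumes F: "closed F" "x0 \<in> F" and X: "tangent_field F X" and Y: "tangent_field F Y" and r: "r > 0"
    and f: "real_polynomial_function f"
    and strict: "\<And>y. y \<in> F \<Longrightarrow> y \<in> cball x0 r \<Longrightarrow> y \<noteq> x0 \<Longrightarrow> f y < f x0"
  shows "vf_apply Y (vf_apply X f) x0 \<le> vf_apply X (vf_apply Y f) x0"
proof -
  define K where "K = F \<inter> cball x0 r"
  define a b aa ba ab bb where ab: "a = vf_apply X f" "b = vf_apply Y f"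
    "aa = vf_apply X a" "ba = vf_apply Y a" "ab = vf_apply X b" "bb = vf_apply Y b"
  note pX = tangent_field_polynomial [OF X] and pY = tangent_field_polynomial [OF Y]
  have p: "real_polynomial_function a" "real_polynomial_function b" "real_polynomial_function aa"
    "real_polynomial_function ba" "real_polynomial_function ab" "real_polynomial_function bb"
    unfolding ab using pX pY f by (simp_all add: real_polynomial_function_vf_apply)
  have step: "\<exists>C. \<forall>\<^sub>F t in at_right 0. \<forall>x\<in>K. \<exists>y\<in>K.
      f x + t * g1 x + t\<^sup>2 * g2 x \<le> f y + t * f1 y + t\<^sup>2 * f2 y + C * t ^ 3"
    if Z: "tangent_field F Z" and q: "real_polynomial_function f1" "real_polynomial_function f2"
      and g: "\<And>x. g1 x = f1 x + c * vf_apply Z f x"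
        "\<And>x. g2 x = f2 x + c * vf_apply Z f1 x + c\<^sup>2 * vf_apply Z (vf_apply Z f) x / 2"
    for Z f1 f2 g1 g2 c
  proof -
    have e: "vf_apply (\<lambda>x. c *\<^sub>R Z x) h = (\<lambda>x. c * vf_apply Z h x)"
      if "real_polynomial_function h" for h
      using that vf_apply_field_scale by blast
    have pz: "real_polynomial_function (vf_apply Z f)"
      using f tangent_field_polynomial [OF Z] by (simp add: real_polynomial_function_vf_apply)
    have pcz: "real_polynomial_function (\<lambda>x. c * vf_apply Z f x)"
      by (intro real_polynomial_function_mult real_polynomial_function_const pz)
    have "f y < f x0" if "y \<in> F" "dist x0 y = r" for y
      using strict [of y] that r by auto
    from flow_step [OF F tangent_field_scale [OF Z, of c] r f q this]
    show ?thesis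
      unfolding K_def g e [OF f] e [OF q(1)] e [OF pcz] vf_apply_cmult [OF pz]
      by (simp add: power2_eq_square mult.assoc)
  qed
  \<comment> \<open>The left-hand sides of the four claims are the expansions of \<open>f\<close>
    after applying the flow operators of X, then Y, then -X, then -Y, and each right-hand side is
    the preceding stage. In the last one all but the commutator \<open>ba - ab\<close> has
    cancelled. Chained from the fourth to the first, they lead from \<open>x0\<close> to a point
    \<open>y1\<close> of \<open>K\<close> with \<open>f y1 \<le> f x0\<close>.\<close>
  have 1: "\<exists>C. \<forall>\<^sub>F t in at_right 0. \<forall>x\<in>K. \<exists>y\<in>K.
      f x + t * a x + t\<^sup>2 * (aa x / 2) \<le> f y + t * 0 + t\<^sup>2 * 0 + C * t ^ 3"
    by (rule step [OF X, where c = 1])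
      (simp_all add: real_polynomial_function_const vf_apply_const ab)
  have 2: "\<exists>C. \<forall>\<^sub>F t in at_right 0. \<forall>x\<in>K. \<exists>y\<in>K.
      f x + t * (a x + b x) + t\<^sup>2 * (aa x / 2 + ba x + bb x / 2)
      \<le> f y + t * a y + t\<^sup>2 * (aa y / 2) + C * t ^ 3"
    by (rule step [OF Y, where c = 1])
      (simp_all add: p ab [symmetric] real_polynomial_function_divide)
  have 3: "\<exists>C. \<forall>\<^sub>F t in at_right 0. \<forall>x\<in>K. \<exists>y\<in>K.
      f x + t * b x + t\<^sup>2 * (ba x - ab x + bb x / 2)
      \<le> f y + t * (a y + b y) + t\<^sup>2 * (aa y / 2 + ba y + bb y / 2) + C * t ^ 3"
    by (rule step [OF X, where c = "-1"])
      (simp_all add: p vf_apply_add ab [symmetric] real_polynomial_function_divide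
        real_polynomial_function_add)
  have 4: "\<exists>C. \<forall>\<^sub>F t in at_right 0. \<forall>x\<in>K. \<exists>y\<in>K.
      f x + t * 0 + t\<^sup>2 * (ba x - ab x)
      \<le> f y + t * b y + t\<^sup>2 * (ba y - ab y + bb y / 2) + C * t ^ 3"
    by (rule step [OF Y, where c = "-1"])
      (simp_all add: p ab [symmetric] real_polynomial_function_divide
        real_polynomial_function_add real_polynomial_function_diff)
  from 1 2 3 4 obtain C1 C2 C3 C4 where C:
    "\<forall>\<^sub>F t in at_right 0. \<forall>x\<in>K. \<exists>y\<in>K.
      f x + t * a x + t\<^sup>2 * (aa x / 2) \<le> f y + t * 0 + t\<^sup>2 * 0 + C1 * t ^ 3"
    "\<forall>\<^sub>F t in at_right 0. \<forall>x\<in>K. \<exists>y\<in>K.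
      f x + t * (a x + b x) + t\<^sup>2 * (aa x / 2 + ba x + bb x / 2)
      \<le> f y + t * a y + t\<^sup>2 * (aa y / 2) + C2 * t ^ 3"
    "\<forall>\<^sub>F t in at_right 0. \<forall>x\<in>K. \<exists>y\<in>K.
      f x + t * b x + t\<^sup>2 * (ba x - ab x + bb x / 2)
      \<le> f y + t * (a y + b y) + t\<^sup>2 * (aa y / 2 + ba y + bb y / 2) + C3 * t ^ 3"
    "\<forall>\<^sub>F t in at_right 0. \<forall>x\<in>K. \<exists>y\<in>K.
      f x + t * 0 + t\<^sup>2 * (ba x - ab x)
      \<le> f y + t * b y + t\<^sup>2 * (ba y - ab y + bb y / 2) + C4 * t ^ 3"
    by blast
  have "\<forall>\<^sub>F t in at_right 0. ba x0 - ab x0 \<le> (C1 + C2 + C3 + C4) * t"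
    using C eventually_at_right_less [of 0]
  proof eventually_elim
    case (elim t)
    have "x0 \<in> K" using F r by (simp add: K_def)
    with elim(4) obtain y4 where y4: "y4 \<in> K" "f x0 + t * 0 + t\<^sup>2 * (ba x0 - ab x0)
      \<le> f y4 + t * b y4 + t\<^sup>2 * (ba y4 - ab y4 + bb y4 / 2) + C4 * t ^ 3" by blast
    from elim(3) y4(1) obtain y3 where y3: "y3 \<in> K" "f y4 + t * b y4 + t\<^sup>2 * (ba y4 - ab y4 + bb y4 / 2)
      \<le> f y3 + t * (a y3 + b y3) + t\<^sup>2 * (aa y3 / 2 + ba y3 + bb y3 / 2) + C3 * t ^ 3" by blast
    from elim(2) y3(1) obtain y2 where y2: "y2 \<in> K"
      "f y3 + t * (a y3 + b y3) + t\<^sup>2 * (aa y3 / 2 + ba y3 + bb y3 / 2)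
      \<le> f y2 + t * a y2 + t\<^sup>2 * (aa y2 / 2) + C2 * t ^ 3" by blast
    from elim(1) y2(1) obtain y1 where y1: "y1 \<in> K"
      "f y2 + t * a y2 + t\<^sup>2 * (aa y2 / 2) \<le> f y1 + t * 0 + t\<^sup>2 * 0 + C1 * t ^ 3" by blast
    have "f y1 \<le> f x0" using strict [of y1] y1(1) by (cases "y1 = x0") (auto simp: K_def)
    then have "t\<^sup>2 * (ba x0 - ab x0) \<le> C1 * t ^ 3 + C2 * t ^ 3 + C3 * t ^ 3 + C4 * t ^ 3"
      using y1(2) y2(2) y3(2) y4(2) by simp
    also have "\<dots> = t\<^sup>2 * ((C1 + C2 + C3 + C4) * t)"
      by (simp add: power2_eq_square power3_eq_cube algebra_simps)
    finally show ?case using elim(5) by simp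
  qed
  moreover have "((\<lambda>t. (C1 + C2 + C3 + C4) * t) \<longlongrightarrow> (C1 + C2 + C3 + C4) * 0) (at_right 0)"
    by (intro tendsto_intros)
  ultimately have "ba x0 - ab x0 \<le> (C1 + C2 + C3 + C4) * 0"
    using tendsto_lowerbound trivial_limit_at_right_real by blast
  then show ?thesis by (simp add: ab)
qed

text \<open>Subtracting the squared distance makes the maximum strict and leaves first derivatives
  at \<open>x\<close> unchanged. The one-sided inequality and its version with the fields exchanged
  give equality.\<close>

lemma tangent_field_lie_bracket:
  fixes F :: "(real^'n) set"
  assumes F: "closed F" and X: "tangent_field F X" and Y: "tangent_field F Y"
  shows "tangent_field F (lie_bracket X Y)"
  unfolding tangent_field_def
proof (intro conjI allI impI)
  note pX = tangent_field_polynomial [OF X] and pY = tangent_field_polynomial [OF Y]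
  show "polynomial_function (lie_bracket X Y)" using pX pY by (rule polynomial_function_lie_bracket)
  fix f x and r :: real
  assume f: "real_polynomial_function f" and x: "x \<in> F" and r: "r > 0"
    and max: "\<forall>y\<in>F \<inter> ball x r. f y \<le> f x"
  define N where "N = (\<lambda>y. (norm (y - x))\<^sup>2)"
  have pN: "real_polynomial_function N"
    unfolding N_def by (rule real_polynomial_function_norm_diff_power2)
  define g where "g = (\<lambda>y. f y - N y)"
  have pg: "real_polynomial_function g"
    unfolding g_def by (intro real_polynomial_function_diff f pN)
  have r2: "r / 2 > 0" using r by simp
  have strict: "g y < g x" if "y \<in> F" "y \<in> cball x (r / 2)" "y \<noteq> x" for y
  proof -
    have "f y \<le> f x" using max that r by auto
    moreover have "N y > 0" "N x = 0" using that by (simp_all add: N_def)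
    ultimately show ?thesis unfolding g_def by linarith
  qed
  have "vf_apply (lie_bracket X Y) g x = 0"
    unfolding vf_apply_lie_bracket [OF pX pY pg]
    using tangent_field_commutator_le [OF F x X Y r2 pg strict]
      tangent_field_commutator_le [OF F x Y X r2 pg strict] by simp
  then show "vf_apply (lie_bracket X Y) f x = 0"
    unfolding g_def vf_apply_diff [OF f pN] by (simp add: N_def vf_apply_norm_diff_power2)
qed

lemma tangent_field_lie_algebra:
  assumes "closed F" "\<And>X. X \<in> G \<Longrightarrow> tangent_field F X" "Y \<in> lie_algebra G"
  shows "tangent_field F Y"
  using assms(3)
  by (induction rule: lie_algebra.induct)
    (use assms(1,2) in \<open>simp_all add: tangent_field_zero tangent_field_add tangent_field_scale
      tangent_field_lie_bracket\<close>)

text \<open>At a point \<open>z\<close> of \<open>F\<close> nearest to \<open>p\<close>, minus the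
  squared distance to \<open>p\<close> is maximal over \<open>F\<close>. So the whole Lie algebra at
  \<open>z\<close> is orthogonal to \<open>z - p\<close>, and its values span the space.\<close>

lemma tangent_bracket_generating_imp_UNIV:
  fixes F :: "(real^'n) set"
  assumes F: "closed F" "F \<noteq> {}" and G: "\<And>X. X \<in> G \<Longrightarrow> tangent_field F X"
    and span: "\<And>x. span ((\<lambda>Y. Y x) ` lie_algebra G) = UNIV"
  shows "F = UNIV"
proof -
  have "p \<in> F" for p
  proof -
    obtain z where z: "z \<in> F" and min: "\<And>y. y \<in> F \<Longrightarrow> dist p z \<le> dist p y"
      using distance_attains_inf [OF F, of p] by blast
    have "Y z \<bullet> (z - p) = 0" if Y: "Y \<in> lie_algebra G" for Y
    proof -
      have "vf_apply Y (\<lambda>x. (-1) * (norm (x - p))\<^sup>2) z = 0"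
      proof (rule tangent_fieldD [OF tangent_field_lie_algebra [OF F(1) G Y] _ z zero_less_one])
        show "real_polynomial_function (\<lambda>x. (-1) * (norm (x - p))\<^sup>2)"
          by (intro real_polynomial_function_mult real_polynomial_function_const
              real_polynomial_function_norm_diff_power2)
        show "(-1) * (norm (y - p))\<^sup>2 \<le> (-1) * (norm (z - p))\<^sup>2" if "y \<in> F" for y
          using min [OF that] by (simp add: dist_norm norm_minus_commute)
      qed
      then show ?thesis
        unfolding vf_apply_cmult [OF real_polynomial_function_norm_diff_power2]
        by (simp add: vf_apply_norm_diff_power2)
    qed
    then have "orthogonal (z - p) w" if "w \<in> (\<lambda>Y. Y z) ` lie_algebra G" for w
      using that by (auto simp: orthogonal_def inner_commute)
    moreover have "z - p \<in> span ((\<lambda>Y. Y z) ` lie_algebra G)" unfolding span by (rule UNIV_I)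
    ultimately have "orthogonal (z - p) (z - p)" by (rule orthogonal_to_span [rotated])
    then show "p \<in> F" using z by (simp add: orthogonal_def)
  qed
  then show ?thesis by blast
qed


section \<open>The strong maximum principle at infinity\<close>

text \<open>Without a maximum the open sets \<open>{x. f x < f y}\<close> cover \<open>K\<close>,
  but a finite subcover misses its own index of largest value.\<close>

lemma usc_attains_sup:
  fixes f :: "'a::topological_space \<Rightarrow> real"
  assumes K: "compact K" "K \<noteq> {}" and usc: "\<And>a. open {x. f x < a}"
  shows "\<exists>x\<in>K. \<forall>y\<in>K. f y \<le> f x"
proof (rule ccontr)
  assume "\<not> ?thesis"
  then have *: "\<forall>x\<in>K. \<exists>y\<in>K. f x < f y" by force
  then have "K \<subseteq> (\<Union>y\<in>K. {x. f x < f y})" by blast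
  then obtain T where T: "T \<subseteq> K" "finite T" "K \<subseteq> (\<Union>y\<in>T. {x. f x < f y})"
    using compactE_image [OF K(1), of K "\<lambda>y. {x. f x < f y}"] usc by metis
  then have "T \<noteq> {}" using K(2) by blast
  then obtain y where y: "y \<in> T" "f y = Max (f ` T)"
    using Max_in [of "f ` T"] T(2) by fastforce
  then obtain z where "z \<in> T" "f y < f z" using T by blast
  then show False using y T(2) Max_ge [of "f ` T" "f z"] by (simp add: not_less [symmetric])
qed

lemma usc_add_continuous:
  fixes f g :: "'a::topological_space \<Rightarrow> real"
  assumes f: "\<And>a. open {x. f x < a}" and g: "continuous_on UNIV g"
  shows "open {x. f x + g x < a}"
proof -
  have "{x. f x + g x < a} = (\<Union>b. {x. f x < b} \<inter> {x. g x < a - b})" (is "_ = ?R")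
  proof
    show "{x. f x + g x < a} \<subseteq> ?R"
    proof
      fix x assume "x \<in> {x. f x + g x < a}"
      then have "f x < (f x + (a - g x)) / 2" "g x < a - (f x + (a - g x)) / 2"
        by (simp_all add: field_simps)
      then show "x \<in> ?R" by blast
    qed
  qed auto
  moreover have "open {x. g x < b}" for b
    using g by (intro open_Collect_less continuous_on_const)
  ultimately show ?thesis using f by (simp add: open_UN open_Int)
qed

context hoermander
begin

text \<open>The set where the upper relaxed limit of the rescalings of v at large scales is at least M.\<close>

definition peak :: "((real, 'n) vec \<Rightarrow> real) \<Rightarrow> real \<Rightarrow> (real, 'n) vec set" where
  "peak v M = {x. \<forall>\<epsilon>>0. \<exists>r>1/\<epsilon>. \<exists>y\<in>ball x \<epsilon>. v (dilation \<sigma> r y) > M - \<epsilon>}"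

lemma closed_peak: "closed (peak v M)"
  unfolding closed_limpt
proof (intro allI impI)
  fix x assume x: "x islimpt peak v M"
  show "x \<in> peak v M"
    unfolding peak_def
  proof (intro CollectI allI impI)
    fix \<epsilon> :: real assume \<epsilon>: "\<epsilon> > 0"
    then obtain x' where x': "x' \<in> peak v M" "dist x' x < \<epsilon> / 2"
      using x unfolding islimpt_approachable by (metis half_gt_zero)
    then obtain r y where r: "r > 1 / (\<epsilon> / 2)" "y \<in> ball x' (\<epsilon> / 2)" "v (dilation \<sigma> r y) > M - \<epsilon> / 2"
      using half_gt_zero [OF \<epsilon>] unfolding peak_def by blast
    have "1 / \<epsilon> < 1 / (\<epsilon> / 2)" using \<epsilon> by (simp add: field_simps)
    moreover have "y \<in> ball x \<epsilon>"
      using r(2) x'(2) dist_triangle [of x y x'] by (simp add: dist_commute)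
    ultimately show "\<exists>r>1/\<epsilon>. \<exists>y\<in>ball x \<epsilon>. v (dilation \<sigma> r y) > M - \<epsilon>"
      using r \<epsilon> by (intro exI [of _ r] conjI bexI [of _ y]) auto
  qed
qed

text \<open>Compactness turns the pointwise failure of the peak condition into one number, which is
  both the gap in value and the bound on the scale.\<close>

lemma peak_compact_gap:
  assumes K: "compact K" "K \<inter> peak v M = {}"
  obtains \<kappa> where "\<kappa> > 0" "\<And>r y. r > 1 / \<kappa> \<Longrightarrow> y \<in> K \<Longrightarrow> v (dilation \<sigma> r y) \<le> M - \<kappa>"
proof -
  have "\<forall>z\<in>K. \<exists>\<epsilon>>0. \<forall>r>1/\<epsilon>. \<forall>y\<in>ball z \<epsilon>. v (dilation \<sigma> r y) \<le> M - \<epsilon>"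
  proof
    fix z assume "z \<in> K"
    then have "z \<notin> peak v M" using K(2) by blast
    then obtain \<epsilon> where \<epsilon>: "\<epsilon> > 0" "\<not> (\<exists>r>1/\<epsilon>. \<exists>y\<in>ball z \<epsilon>. v (dilation \<sigma> r y) > M - \<epsilon>)"
      unfolding peak_def by blast
    then have "\<forall>r>1/\<epsilon>. \<forall>y\<in>ball z \<epsilon>. v (dilation \<sigma> r y) \<le> M - \<epsilon>" by (meson not_le)
    with \<epsilon>(1) show "\<exists>\<epsilon>>0. \<forall>r>1/\<epsilon>. \<forall>y\<in>ball z \<epsilon>. v (dilation \<sigma> r y) \<le> M - \<epsilon>" by blast
  qed
  then obtain e where e: "\<And>z. z \<in> K \<Longrightarrow> e z > 0"
    "\<And>z r y. z \<in> K \<Longrightarrow> r > 1 / e z \<Longrightarrow> y \<in> ball z (e z) \<Longrightarrow> v (dilation \<sigma> r y) \<le> M - e z"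
    by metis
  have "K \<subseteq> (\<Union>z\<in>K. ball z (e z))" using e(1) by auto
  then obtain T where T: "T \<subseteq> K" "finite T" "K \<subseteq> (\<Union>z\<in>T. ball z (e z))"
    using compactE_image [OF K(1), of K "\<lambda>z. ball z (e z)"] by (metis open_ball)
  \<comment> \<open>The inserted 1 covers an empty \<open>T\<close>.\<close>
  define \<kappa> where "\<kappa> = Min (insert 1 (e ` T))"
  show thesis
  proof
    show k: "\<kappa> > 0" using T e(1) by (auto simp: \<kappa>_def)
    fix r y assume r: "r > 1 / \<kappa>" and y: "y \<in> K"
    then obtain z where z: "z \<in> T" "y \<in> ball z (e z)" using T by blast
    have "\<kappa> \<le> e z" using z T by (simp add: \<kappa>_def)
    moreover from this have "1 / e z \<le> 1 / \<kappa>" using k by (simp add: frac_le)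
    ultimately show "v (dilation \<sigma> r y) \<le> M - \<kappa>"
      using e(2) [of z r y] z T r by fastforce
  qed
qed

lemma open_vimage_dilation: "open S \<Longrightarrow> open {x. dilation \<sigma> r x \<in> S}"
  using open_vimage [of S "dilation \<sigma> r"]
  by (simp add: vimage_def linear_continuous_on bounded_linear_dilation)

text \<open>A barrier of Hopf type.  With g = f - f(x0), the function g + A g^2 - |x - x0|^2 is
  negative on the peak set near x0, and is strictly subharmonic there for large A
  if some field does not kill f at x0.\<close>

lemma peak_tangent:
  assumes usc: "\<And>a. open {x. v x < a}" and v: "\<And>x. v x \<le> M" and M: "M > 0"
    and test: "\<And>\<phi> z \<rho>. real_polynomial_function \<phi> \<Longrightarrow> \<rho> > 0 \<Longrightarrow> v z > 0 \<Longrightarrow> \<phi> z = v z \<Longrightarrow>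
      (\<And>x. x \<in> ball z \<rho> \<Longrightarrow> v x \<le> \<phi> x) \<Longrightarrow> L \<phi> z \<ge> 0"
    and i: "i \<in> {1..m}"
  shows "tangent_field (peak v M) (X i)"
  unfolding tangent_field_def
proof (intro conjI allI impI)
  show "polynomial_function (X i)" using i by (rule X_polynomial)
  fix f x0 and r0 :: real
  assume f: "real_polynomial_function f" and x0: "x0 \<in> peak v M" and r0: "r0 > 0"
    and max: "\<forall>y\<in>peak v M \<inter> ball x0 r0. f y \<le> f x0"
  show "D i f x0 = 0"
  proof (rule ccontr)
    assume nz: "D i f x0 \<noteq> 0"
    define N where "N = (\<lambda>x. (norm (x - x0))\<^sup>2)"
    define g where "g = (\<lambda>x. f x - f x0)"
    define S where "S = (\<Sum>j=1..m. (D j f x0)\<^sup>2)"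
    \<comment> \<open>Chosen so that \<open>A * (2 * S)\<close> outweighs
      \<open>L f x0 - L N x0\<close> whatever its sign.\<close>
    define A where "A = (\<bar>L f x0 - L N x0\<bar> + 1) / S"
    define w where "w = (\<lambda>x. (g x + A * (g x)\<^sup>2) - N x)"
    have pN: "real_polynomial_function N"
      unfolding N_def by (rule real_polynomial_function_norm_diff_power2)
    have pg: "real_polynomial_function g"
      unfolding g_def by (intro real_polynomial_function_diff f real_polynomial_function_const)
    have pg2: "real_polynomial_function (\<lambda>x. (g x)\<^sup>2)"
      by (intro real_polynomial_function_power pg)
    have pAg2: "real_polynomial_function (\<lambda>x. A * (g x)\<^sup>2)"
      by (intro real_polynomial_function_mult real_polynomial_function_const pg2)
    have pgA: "real_polynomial_function (\<lambda>x. g x + A * (g x)\<^sup>2)"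
      by (intro real_polynomial_function_add pg pAg2)
    have pw: "real_polynomial_function w"
      unfolding w_def by (intro real_polynomial_function_diff pgA pN)
    have "(D i f x0)\<^sup>2 \<le> S"
      unfolding S_def using i by (intro member_le_sum) auto
    then have S: "S > 0" using nz by (metis zero_less_power2 less_le_trans)
    have A: "A > 0" using S by (simp add: A_def)
    have Dg: "D j g = D j f" for j
      unfolding g_def using f
      by (simp add: vf_apply_diff real_polynomial_function_const vf_apply_const)
    have "L (\<lambda>x. (g x)\<^sup>2) x0 = 2 * S"
      using L_power2_at_zero [OF pg, of x0] by (simp add: Dg S_def) (simp add: g_def)
    moreover have "L g x0 = L f x0" by (simp add: sum_of_squares_def Dg)
    ultimately have "L w x0 = L f x0 + A * (2 * S) - L N x0"
      unfolding w_def by (simp only: L_diff [OF pgA pN] L_add [OF pg pAg2] L_cmult [OF pg2])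
    then have "L w x0 = L f x0 - L N x0 + 2 * (\<bar>L f x0 - L N x0\<bar> + 1)"
      using S by (simp add: A_def)
    moreover have "c + 2 * (\<bar>c\<bar> + 1) > 0" for c :: real by (cases "c \<ge> 0") simp_all
    ultimately have "L w x0 > 0" by simp
    moreover have "isCont (L w) x0" using L_polynomial [OF pw] by (rule continuous_real_polymonial_function)
    ultimately have "\<forall>\<^sub>F x in at x0. L w x > 0"
      unfolding isCont_def by (rule order_tendstoD(1) [rotated])
    then obtain d1 where d1: "d1 > 0" "\<And>x. dist x x0 < d1 \<Longrightarrow> L w x > 0"
      unfolding eventually_at using \<open>L w x0 > 0\<close> by (metis UNIV_I)
    have "isCont g x0" using pg by (rule continuous_real_polymonial_function)
    then have "(g \<longlongrightarrow> 0) (at x0)" by (simp add: isCont_def g_def)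
    then have "\<forall>\<^sub>F x in at x0. g x > - (1 / A)"
      by (rule order_tendstoD(1)) (use A in simp)
    then obtain d2 where d2: "d2 > 0" "\<And>x. dist x x0 < d2 \<Longrightarrow> g x > - (1 / A)"
      unfolding eventually_at using A by (metis UNIV_I g_def diff_self neg_less_0_iff_less zero_less_divide_1_iff)
    define \<rho> where "\<rho> = min r0 (min d1 d2) / 2"
    have \<rho>: "\<rho> > 0" "\<rho> < r0" "\<rho> < d1" "\<rho> < d2" using r0 d1(1) d2(1) by (auto simp: \<rho>_def min_def)
    \<comment> \<open>On the peak set \<open>g\<close> is nonpositive, and near \<open>x0\<close>
      the factor \<open>1 + A * g\<close> is nonnegative, so the square does not spoil the
      sign.\<close>
    have w_peak: "w y \<le> - (norm (y - x0))\<^sup>2" if "y \<in> peak v M" "y \<in> cball x0 \<rho>" for y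
    proof -
      have "g y \<le> 0" using max that \<rho> by (auto simp: g_def)
      moreover have "1 + A * g y \<ge> 0"
        using d2(2) [of y] that \<rho> A by (simp add: dist_commute field_simps)
      ultimately have "g y * (1 + A * g y) \<le> 0" by (rule mult_nonpos_nonneg)
      then show ?thesis by (simp add: w_def N_def algebra_simps power2_eq_square)
    qed
    have cw: "continuous_on T w" for T using pw by (rule continuous_on_real_polynomial_function)
    \<comment> \<open>The part of the sphere where \<open>w\<close> alone does not push below
      \<open>M\<close>. It misses the peak set, so there the rescaled \<open>v\<close> has a
      gap.\<close>
    define K where "K = {y \<in> sphere x0 \<rho>. w y \<ge> - (\<rho>\<^sup>2 / 2)}"
    have "compact K"
    proof -
      have "closed {y. w y \<ge> - (\<rho>\<^sup>2 / 2)}" by (intro closed_Collect_le continuous_on_const cw)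
      moreover have "K = sphere x0 \<rho> \<inter> {y. w y \<ge> - (\<rho>\<^sup>2 / 2)}" by (auto simp: K_def)
      ultimately show ?thesis by (simp add: compact_Int_closed)
    qed
    moreover have "K \<inter> peak v M = {}"
    proof -
      have False if "y \<in> K" "y \<in> peak v M" for y
      proof -
        have "norm (y - x0) = \<rho>" using that by (simp add: K_def dist_norm norm_minus_commute)
        then have "w y \<le> - \<rho>\<^sup>2" using w_peak [of y] that by (simp add: K_def)
        moreover have "\<rho>\<^sup>2 > 0" using \<rho> by simp
        moreover have "w y \<ge> - (\<rho>\<^sup>2 / 2)" using that by (simp add: K_def)
        ultimately show False by linarith
      qed
      then show ?thesis by blast
    qed
    ultimately obtain \<kappa>1 where \<kappa>1: "\<kappa>1 > 0"
      "\<And>r y. r > 1 / \<kappa>1 \<Longrightarrow> y \<in> K \<Longrightarrow> v (dilation \<sigma> r y) \<le> M - \<kappa>1"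
      using peak_compact_gap by blast
    obtain B where B: "B \<ge> 0" "\<And>y. y \<in> cball x0 \<rho> \<Longrightarrow> \<bar>w y\<bar> \<le> B"
      using bounded_real_polynomial_function [OF compact_cball pw] by blast
    \<comment> \<open>Small enough for \<open>\<epsilon> * w\<close> to preserve both the gap on
      \<open>K\<close> and the positivity of \<open>v\<close> at the maximum point.\<close>
    define \<epsilon> where "\<epsilon> = min \<kappa>1 M / (4 * (B + 1))"
    have \<epsilon>: "\<epsilon> > 0" using \<kappa>1(1) M B(1) by (simp add: \<epsilon>_def)
    have \<epsilon>w: "\<epsilon> * w y \<le> \<kappa>1 / 4" "\<epsilon> * w y \<le> M / 4" if "y \<in> cball x0 \<rho>" for y
    proof -
      have "\<epsilon> * w y \<le> \<epsilon> * (B + 1)" using \<epsilon> B(2) [OF that] by (intro mult_left_mono) auto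
      also have "\<epsilon> * (B + 1) = min \<kappa>1 M / 4"
        using B(1) by (simp add: \<epsilon>_def field_simps)
      finally show "\<epsilon> * w y \<le> \<kappa>1 / 4" "\<epsilon> * w y \<le> M / 4" by auto
    qed
    \<comment> \<open>The three entries serve the sphere inside \<open>K\<close>, the sphere outside
      \<open>K\<close>, and the bound \<open>v z > M - M / 2 - M / 4 > 0\<close> at the touching
      point.\<close>
    define \<kappa> where "\<kappa> = min (\<kappa>1 / 2) (min (\<epsilon> * (\<rho>\<^sup>2 / 2)) (M / 2))"
    have \<kappa>: "\<kappa> > 0" "\<kappa> \<le> \<kappa>1 / 2" "\<kappa> \<le> \<epsilon> * (\<rho>\<^sup>2 / 2)" "\<kappa> \<le> M / 2"
      using \<kappa>1(1) \<epsilon> \<rho>(1) M by (auto simp: \<kappa>_def)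
    have sphere: "v (dilation \<sigma> r y) + \<epsilon> * w y \<le> M - \<kappa>" if "r > 1 / \<kappa>1" "dist x0 y = \<rho>" for r y
    proof (cases "y \<in> K")
      case True
      then show ?thesis using \<kappa>1(2) [OF that(1) True] \<epsilon>w(1) [of y] that \<kappa> \<kappa>1(1) by simp
    next
      case False
      then have "w y \<le> - (\<rho>\<^sup>2 / 2)" using that by (simp add: K_def)
      then have "\<epsilon> * w y \<le> \<epsilon> * - (\<rho>\<^sup>2 / 2)" using \<epsilon> by (intro mult_left_mono) auto
      then show ?thesis using v [of "dilation \<sigma> r y"] \<kappa>(3) by simp
    qed
    have "((\<lambda>y. \<epsilon> * w y) \<longlongrightarrow> \<epsilon> * w x0) (at x0)"
      using pw by (intro tendsto_intros) (simp add: continuous_real_polymonial_function flip: isCont_def)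
    moreover have w0: "w x0 = 0" by (simp add: w_def g_def N_def)
    ultimately have "\<forall>\<^sub>F y in at x0. \<epsilon> * w y > - (\<kappa> / 2)"
      using \<kappa>(1) by (intro order_tendstoD(1)) auto
    then obtain d3 where d3: "d3 > 0" "\<And>y. dist y x0 < d3 \<Longrightarrow> \<epsilon> * w y > - (\<kappa> / 2)"
      unfolding eventually_at using w0 \<kappa>(1)
      by (metis UNIV_I half_gt_zero mult_zero_right neg_less_0_iff_less)
    \<comment> \<open>The peak condition with this number yields a point where \<open>v\<close>
      loses less than \<open>\<kappa> / 2\<close> from \<open>M\<close> and
      \<open>\<epsilon> * w\<close> loses less than \<open>\<kappa> / 2\<close> from 0, which beats
      the sphere.\<close>
    define \<epsilon>' where "\<epsilon>' = min (min \<kappa>1 \<rho>) (min (\<kappa> / 2) d3)"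
    have \<epsilon>': "\<epsilon>' > 0" "\<epsilon>' \<le> \<kappa>1" "\<epsilon>' \<le> \<rho>" "\<epsilon>' \<le> \<kappa> / 2" "\<epsilon>' \<le> d3"
      using \<kappa>1(1) \<rho>(1) \<kappa>(1) d3(1) by (auto simp: \<epsilon>'_def)
    obtain r y where r: "r > 1 / \<epsilon>'" and y: "y \<in> ball x0 \<epsilon>'" "v (dilation \<sigma> r y) > M - \<epsilon>'"
      using x0 \<epsilon>'(1) unfolding peak_def by blast
    have "1 / \<kappa>1 \<le> 1 / \<epsilon>'" using \<epsilon>' by (simp add: frac_le)
    with r have r1: "r > 1 / \<kappa>1" by simp
    have rpos: "r > 0" using r \<epsilon>'(1) by (meson less_trans zero_less_divide_1_iff)
    define \<Phi> where "\<Phi> = (\<lambda>y. v (dilation \<sigma> r y) + \<epsilon> * w y)"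
    have "open {y. v (dilation \<sigma> r y) < a}" for a
      using open_vimage_dilation [OF usc [of a], of r] by simp
    then have "open {y. \<Phi> y < a}" for a
      unfolding \<Phi>_def by (rule usc_add_continuous) (intro continuous_intros cw)
    then obtain ym where ym: "ym \<in> cball x0 \<rho>" "\<And>y. y \<in> cball x0 \<rho> \<Longrightarrow> \<Phi> y \<le> \<Phi> ym"
      using usc_attains_sup [of "cball x0 \<rho>" \<Phi>] \<rho>(1) by fastforce
    have "\<Phi> y > M - \<kappa>"
    proof -
      have "\<epsilon> * w y > - (\<kappa> / 2)" using y(1) \<epsilon>' by (intro d3(2)) (simp add: dist_commute)
      then show ?thesis using y(2) \<epsilon>'(4) by (simp add: \<Phi>_def)
    qed
    moreover have "\<Phi> y \<le> \<Phi> ym" using y(1) \<epsilon>'(3) by (intro ym(2)) simp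
    ultimately have big: "\<Phi> ym > M - \<kappa>" by simp
    then have "dist x0 ym \<noteq> \<rho>" using sphere [OF r1, of ym] by (auto simp: \<Phi>_def)
    then have inside: "ym \<in> ball x0 \<rho>" using ym(1) by simp
    have inv: "dilation \<sigma> (1 / r) (dilation \<sigma> r x) = x" "dilation \<sigma> r (dilation \<sigma> (1 / r) x) = x" for x
      using rpos by (simp_all add: dilation_dilation)
    define z where "z = dilation \<sigma> r ym"
    \<comment> \<open>The barrier moved back to the original scale: it touches \<open>v\<close> from
      above at \<open>z\<close>, and \<open>L \<phi> z\<close> is negative because
      \<open>L w\<close> is positive near \<open>x0\<close>.\<close>
    define \<phi> where "\<phi> = (\<lambda>x. \<Phi> ym - \<epsilon> * w (dilation \<sigma> (1 / r) x))"
    have pwd: "real_polynomial_function (\<lambda>x. w (dilation \<sigma> (1 / r) x))"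
      using pw by (rule real_polynomial_function_dilation)
    have pewd: "real_polynomial_function (\<lambda>x. \<epsilon> * w (dilation \<sigma> (1 / r) x))"
      by (intro real_polynomial_function_mult real_polynomial_function_const pwd)
    have p\<phi>: "real_polynomial_function \<phi>"
      unfolding \<phi>_def by (intro real_polynomial_function_diff real_polynomial_function_const pewd)
    have "open {x. dilation \<sigma> (1 / r) x \<in> ball x0 \<rho>}" by (rule open_vimage_dilation) simp
    moreover have "z \<in> {x. dilation \<sigma> (1 / r) x \<in> ball x0 \<rho>}" using inside by (simp add: z_def inv)
    ultimately obtain \<rho>' where \<rho>': "\<rho>' > 0" "ball z \<rho>' \<subseteq> {x. dilation \<sigma> (1 / r) x \<in> ball x0 \<rho>}"
      using open_contains_ball by blast
    have "L \<phi> z \<ge> 0"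
    proof (rule test [OF p\<phi> \<rho>'(1)])
      show "v z > 0" using big \<epsilon>w(2) [OF ym(1)] \<kappa>(4) M by (simp add: \<Phi>_def z_def)
      show "\<phi> z = v z" by (simp add: \<phi>_def \<Phi>_def z_def inv)
      fix x assume "x \<in> ball z \<rho>'"
      then have "dilation \<sigma> (1 / r) x \<in> cball x0 \<rho>" using \<rho>'(2) by force
      from ym(2) [OF this] show "v x \<le> \<phi> x" by (simp add: \<Phi>_def \<phi>_def inv)
    qed
    moreover have "L \<phi> z = - (\<epsilon> * ((1 / r)\<^sup>2 * L w ym))"
      unfolding \<phi>_def using pewd pwd rpos
      by (simp add: L_diff L_const L_cmult L_dilation pw real_polynomial_function_const)
        (simp add: z_def inv)
    moreover have "\<epsilon> * ((1 / r)\<^sup>2 * L w ym) > 0"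
      using \<epsilon> rpos d1(2) [of ym] inside \<rho>(3) by (simp add: dist_commute)
    ultimately show False by linarith
  qed
qed

section \<open>Cones and half-spaces\<close>

text \<open>The complement itself need not be invariant, since the coordinates are stretched by
  different powers. Where all products \<open>a $ i * x $ i\<close> are nonnegative, stretching by
  \<open>r \<ge> 1\<close> can only increase \<open>a \<bullet> x\<close>.\<close>

lemma halfspace_complement_cone:
  assumes "halfspace H" "\<Omega> \<subseteq> H"
  shows "\<exists>C. nondegenerate_cone \<sigma> C \<and> C \<subseteq> - \<Omega>"
proof -
  obtain a :: "(real, 'n) vec" and b where a: "a \<noteq> 0" and H: "H = {x. a \<bullet> x \<le> b}"
    using assms(1) unfolding halfspace_def by blast
  define C where "C = {x. (\<forall>i. a $ i * x $ i \<ge> 0) \<and> a \<bullet> x > b}"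
  define U where "U = {x. (\<forall>i. a $ i = 0 \<or> a $ i * x $ i > 0) \<and> a \<bullet> x > b}"
  have "open U"
  proof -
    have "U = (\<Inter>i. {x. a $ i = 0} \<union> {x. 0 < a $ i * x $ i}) \<inter> {x. b < a \<bullet> x}"
      unfolding U_def by blast
    moreover have "open {x. 0 < a $ i * x $ i}" for i
      by (intro open_Collect_less continuous_intros)
    moreover have "open {x. b < a \<bullet> x}" by (intro open_Collect_less continuous_intros)
    ultimately show ?thesis by (auto intro!: open_INT open_Un open_Int)
  qed
  moreover have "U \<subseteq> C"
  proof
    fix x assume x: "x \<in> U"
    have "a $ i * x $ i \<ge> 0" for i using x by (cases "a $ i = 0") (auto simp: U_def intro: less_imp_le)
    then show "x \<in> C" using x by (simp add: U_def C_def)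
  qed
  \<comment> \<open>The multiple of \<open>a\<close> whose inner product with \<open>a\<close> is
    \<open>\<bar>b\<bar> + 1 > b\<close>.\<close>
  moreover have "((\<bar>b\<bar> + 1) / (a \<bullet> a)) *\<^sub>R a \<in> U"
  proof -
    define k where "k = (\<bar>b\<bar> + 1) / (a \<bullet> a)"
    have k: "k > 0" "k * (a \<bullet> a) = \<bar>b\<bar> + 1" using a by (simp_all add: k_def divide_pos_pos)
    have "a $ i * (k * a $ i) > 0" if "a $ i \<noteq> 0" for i
    proof -
      have "k * (a $ i)\<^sup>2 > 0" using k(1) that by simp
      then show ?thesis by (simp add: power2_eq_square mult_ac)
    qed
    then show ?thesis using k(2) by (auto simp: U_def simp flip: k_def)
  qed
  ultimately have "interior C \<noteq> {}" using interior_maximal by blast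
  moreover have "dilation \<sigma> r x \<in> C" if r: "r \<ge> 1" and x: "x \<in> C" for r x
  proof -
    have le: "a $ i * x $ i \<le> a $ i * (r ^ \<sigma> i * x $ i)" for i
    proof -
      have "1 * (a $ i * x $ i) \<le> r ^ \<sigma> i * (a $ i * x $ i)"
        using x one_le_power [OF r, of "\<sigma> i"] by (intro mult_right_mono) (auto simp: C_def)
      then show ?thesis by (simp add: mult_ac)
    qed
    then have "a \<bullet> x \<le> a \<bullet> dilation \<sigma> r x"
      unfolding inner_vec_def by (intro sum_mono) simp
    moreover have "0 \<le> a $ i * (r ^ \<sigma> i * x $ i)" for i
      using le [of i] x by (auto simp: C_def intro: order_trans)
    ultimately show ?thesis using x by (auto simp: C_def)
  qed
  ultimately have "nondegenerate_cone \<sigma> C"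
    unfolding nondegenerate_cone_def by (intro conjI exI [of _ 1]) auto
  moreover have "C \<subseteq> - \<Omega>" using assms(2) by (auto simp: C_def H)
  ultimately show ?thesis by blast
qed

section \<open>The maximum principle outside a cone\<close>

lemma maximum_principle_set_of_cone:
  assumes \<Omega>: "open \<Omega>" and C: "nondegenerate_cone \<sigma> C" "C \<subseteq> - \<Omega>"
  shows "maximum_principle_set L \<Omega>"
  unfolding maximum_principle_set_def
proof (intro conjI ballI impI \<Omega>)
  fix u x1
  assume "u \<in> subharmonic_bdd_above L \<Omega>" and bd: "\<forall>\<xi>\<in>frontier \<Omega>. Limsup (at \<xi> within \<Omega>) u \<le> 0"
    and x1: "x1 \<in> \<Omega>"
  then obtain M1 where sub: "subharmonic_on L \<Omega> u" and M1: "\<And>x. x \<in> \<Omega> \<Longrightarrow> u x \<le> ereal M1"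
    by (auto simp: subharmonic_bdd_above_def)
  show "u x1 \<le> 0"
  proof (rule ccontr)
    assume "\<not> u x1 \<le> 0"
    \<comment> \<open>Truncation at 0 removes the value minus infinity and makes the extension upper
      semicontinuous, as the boundary condition bounds \<open>u\<close> by 0 from above. Where
      \<open>v\<close> is positive it equals \<open>u\<close>.\<close>
    define v where "v x = (if x \<in> \<Omega> then real_of_ereal (max (u x) 0) else 0)" for x
    have ev: "ereal (v x) = max (u x) 0" if "x \<in> \<Omega>" for x
    proof -
      have "max (u x) 0 \<noteq> \<infinity>" using M1 [OF that] by (auto simp: max_def)
      moreover have "max (u x) 0 \<noteq> -\<infinity>" by (auto simp: max_def)
      ultimately show ?thesis using that by (simp add: v_def ereal_real)
    qed
    have v0: "v x \<ge> 0" for x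
      using ev [of x] by (cases "x \<in> \<Omega>") (auto simp: v_def intro!: real_of_ereal_pos)
    have v_bdd: "v x \<le> max M1 0" for x
    proof (cases "x \<in> \<Omega>")
      case True
      have "ereal (v x) \<le> ereal (max M1 0)"
        unfolding ev [OF True] using M1 [OF True]
        by (intro max.boundedI) (auto simp: max_def zero_ereal_def intro: order_trans)
      then show ?thesis unfolding ereal_less_eq(3) .
    qed (simp add: v_def)
    define M where "M = Sup (range v)"
    have bdd: "bdd_above (range v)" using v_bdd by (auto intro!: bdd_aboveI)
    have vM: "v x \<le> M" for x unfolding M_def using bdd by (intro cSup_upper) auto
    have "v x1 > 0"
    proof -
      have "ereal (v x1) > 0" unfolding ev [OF x1] using \<open>\<not> u x1 \<le> 0\<close> by simp
      then show ?thesis by simp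
    qed
    then have M: "M > 0" using vM [of x1] by linarith
    have usc: "open {x. v x < a}" for a
    proof (cases "a \<le> 0")
      case True
      then have "{x. v x < a} = {}" using v0 by (auto simp: not_less intro: order_trans)
      then show ?thesis by simp
    next
      case False
      have near: "\<exists>e>0. \<forall>x\<in>ball y e. x \<in> \<Omega> \<longrightarrow> u x < ereal a" if y: "v y < a" for y
      proof (cases "y \<in> \<Omega>")
        case True
        have "openin (top_of_set \<Omega>) {x \<in> \<Omega>. u x < ereal a}"
          using sub by (simp add: subharmonic_on_def usc_on_def)
        then have "open {x \<in> \<Omega>. u x < ereal a}" using \<Omega> by (simp add: openin_open_eq)
        moreover have "u y < ereal a"
        proof -
          have "u y \<le> ereal (v y)" unfolding ev [OF True] by simp
          also have "\<dots> < ereal a" using y by simp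
          finally show ?thesis .
        qed
        ultimately obtain e where "e > 0" "ball y e \<subseteq> {x \<in> \<Omega>. u x < ereal a}"
          using True openE [of "{x \<in> \<Omega>. u x < ereal a}" y] by blast
        then show ?thesis by blast
      next
        case notin: False
        show ?thesis
        proof (cases "y \<in> closure \<Omega>")
          case True
          then have "y \<in> frontier \<Omega>" using notin \<Omega> by (simp add: frontier_def interior_open)
          then have "Limsup (at y within \<Omega>) u < ereal a"
            using bd False by (metis ereal_less(2) le_less_trans not_le)
          then have "\<forall>\<^sub>F x in at y within \<Omega>. u x < ereal a" by (rule Limsup_lessD)
          then obtain d where "d > 0" "\<forall>x\<in>\<Omega>. x \<noteq> y \<and> dist x y < d \<longrightarrow> u x < ereal a"
            unfolding eventually_at by blast
          then show ?thesis using notin by (intro exI [of _ d]) (auto simp: dist_commute)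
        next
          case False
          then show ?thesis unfolding closure_approachable by (auto simp: dist_commute)
        qed
      qed
      show ?thesis
        unfolding open_contains_ball
      proof
        fix y assume "y \<in> {x. v x < a}"
        then obtain e where e: "e > 0" "\<forall>x\<in>ball y e. x \<in> \<Omega> \<longrightarrow> u x < ereal a" using near by blast
        have "v x < a" if "x \<in> ball y e" for x
        proof (cases "x \<in> \<Omega>")
          case True
          have "ereal (v x) < ereal a"
            unfolding ev [OF True] using e that True False by (auto simp: max_def zero_ereal_def)
          then show ?thesis by simp
        next
          case False
          then show ?thesis using \<open>\<not> a \<le> 0\<close> by (simp add: v_def)
        qed
        then show "\<exists>e>0. ball y e \<subseteq> {x. v x < a}" using e(1) by blast
      qed
    qed
    have test: "L \<phi> z \<ge> 0" if p: "real_polynomial_function \<phi>" and \<rho>: "\<rho> > 0" and z: "v z > 0" "\<phi> z = v z"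
      and le: "\<And>x. x \<in> ball z \<rho> \<Longrightarrow> v x \<le> \<phi> x" for \<phi> z \<rho>
    proof -
      have z\<Omega>: "z \<in> \<Omega>" using z by (auto simp: v_def split: if_splits)
      then obtain e where e: "e > 0" "ball z e \<subseteq> \<Omega>" using \<Omega> open_contains_ball by blast
      show ?thesis
      proof (rule subharmonic_on_test_function [OF sub _ _ p])
        show "min \<rho> e > 0" using \<rho> e by simp
        show "ball z (min \<rho> e) \<subseteq> \<Omega>" using e by auto
        have "max (u z) 0 > 0" using z(1) ev [OF z\<Omega>] by (metis ereal_less(2))
        then show "u z = ereal (\<phi> z)" using ev [OF z\<Omega>] z(2) by (auto simp: max_def split: if_splits)
        fix x assume x: "x \<in> ball z (min \<rho> e)"
        then have "x \<in> \<Omega>" "v x \<le> \<phi> x" using e le by auto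
        then have "max (u x) 0 \<le> ereal (\<phi> x)" using ev by (metis ereal_less_eq(3))
        then show "u x \<le> ereal (\<phi> x)" by simp
      qed
    qed
    have "0 \<in> peak v M"
      unfolding peak_def
    proof (intro CollectI allI impI)
      fix \<epsilon> :: real assume \<epsilon>: "\<epsilon> > 0"
      have "M - \<epsilon> < Sup (range v)" using \<epsilon> by (simp add: M_def)
      then obtain x where x: "v x > M - \<epsilon>" using less_cSup_iff [of "range v"] bdd by auto
      have "((\<lambda>s. dilation \<sigma> s x) \<longlongrightarrow> 0) (at_right 0)" using sigma_ge_1 by (rule tendsto_dilation_0)
      then have "\<forall>\<^sub>F s in at_right 0. dist (dilation \<sigma> s x) 0 < \<epsilon>" using \<epsilon> by (rule tendstoD)
      moreover have "\<forall>\<^sub>F s in at_right 0. s < \<epsilon>" using \<epsilon> by (auto simp: eventually_at_right_field)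
      ultimately have "\<forall>\<^sub>F s in at_right 0. dist (dilation \<sigma> s x) 0 < \<epsilon> \<and> s < \<epsilon> \<and> 0 < s"
        using eventually_at_right_less [of "0::real"] by eventually_elim auto
      then obtain s where s: "dist (dilation \<sigma> s x) 0 < \<epsilon>" "s < \<epsilon>" "0 < s"
        using eventually_happens' [OF trivial_limit_at_right_real] by blast
      have "1 / s > 1 / \<epsilon>" using s by (simp add: frac_less2)
      moreover have "dilation \<sigma> (1 / s) (dilation \<sigma> s x) = x" using s by (simp add: dilation_dilation)
      ultimately show "\<exists>r>1/\<epsilon>. \<exists>y\<in>ball 0 \<epsilon>. v (dilation \<sigma> r y) > M - \<epsilon>"
        using s x by (intro exI [of _ "1 / s"] conjI bexI [of _ "dilation \<sigma> s x"]) (auto simp: dist_commute)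
    qed
    then have "peak v M \<noteq> {}" by blast
    moreover have "tangent_field (peak v M) Y" if "Y \<in> X ` {1..m}" for Y
    proof -
      obtain i where "i \<in> {1..m}" "Y = X i" using \<open>Y \<in> X ` {1..m}\<close> by blast
      moreover from this(1) have "tangent_field (peak v M) (X i)"
        by (rule peak_tangent [OF usc vM M test, rotated -1])
      ultimately show ?thesis by simp
    qed
    ultimately have "peak v M = UNIV"
      using span_lie_algebra by (rule tangent_bracket_generating_imp_UNIV [OF closed_peak])
    moreover obtain r0 where r0: "r0 > 0" "\<And>r. r \<ge> r0 \<Longrightarrow> dilation \<sigma> r ` C \<subseteq> C"
      using C(1) unfolding nondegenerate_cone_def by blast
    obtain p e where pe: "e > 0" "ball p e \<subseteq> C"
      using C(1) unfolding nondegenerate_cone_def by (auto simp: mem_interior)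
    have "p \<notin> peak v M"
    proof
      assume "p \<in> peak v M"
      \<comment> \<open>The entries keep \<open>y\<close> in the cone, force
        \<open>r \<ge> r0\<close> so that the dilated point remains there, and make
        \<open>M - \<epsilon>\<close> nonnegative although \<open>v\<close> is 0 off
        \<open>\<Omega>\<close>.\<close>
      define \<epsilon> where "\<epsilon> = min e (min (1 / r0) M)"
      have \<epsilon>: "\<epsilon> > 0" "\<epsilon> \<le> e" "\<epsilon> \<le> 1 / r0" "\<epsilon> \<le> M" using pe r0 M by (auto simp: \<epsilon>_def)
      obtain r y where r: "r > 1 / \<epsilon>" and y: "y \<in> ball p \<epsilon>" "v (dilation \<sigma> r y) > M - \<epsilon>"
        using \<open>p \<in> peak v M\<close> \<epsilon>(1) unfolding peak_def by blast
      have "r0 \<le> 1 / \<epsilon>" using \<epsilon> r0 by (simp add: field_simps)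
      then have "dilation \<sigma> r ` C \<subseteq> C" using r by (intro r0(2)) simp
      moreover have "y \<in> C" using y(1) \<epsilon>(2) pe(2) by auto
      ultimately have "dilation \<sigma> r y \<notin> \<Omega>" using C(2) by blast
      then show False using y(2) \<epsilon>(4) by (simp add: v_def)
    qed
    ultimately show False by blast
  qed
qed

end

theorem theorem1p13:
  fixes \<sigma> :: "'n::{finite,linorder} \<Rightarrow> nat"
    and m :: nat
    and X :: "nat \<Rightarrow> (real, 'n) vec \<Rightarrow> (real, 'n) vec"
    and \<Omega> :: "(real, 'n) vec set"
  assumes "CARD('n) \<ge> 3"
    and "homogeneous_hoermander \<sigma> m X"
    and "open \<Omega>"
    and "(\<exists>C. nondegenerate_cone \<sigma> C \<and> C \<subseteq> - \<Omega>) \<or> (\<exists>H. halfspace H \<and> \<Omega> \<subseteq> H)"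
  shows "maximum_principle_set (sum_of_squares m X) \<Omega>"
proof -
  interpret hoermander \<sigma> m X using assms(2) by unfold_locales
  show ?thesis
    using assms(3,4) halfspace_complement_cone maximum_principle_set_of_cone by blast
qed

end
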